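(* Let $f_n:\mathbb{R}\to\mathbb{R}$ ($n\in\mathbb{N}$) be Borel functions such that the graph $\mathcal{G}$ on $\mathbb{R}$ given by $x\,\mathcal{G}\,y\iff\exists n\,(f_n(x)=y\ \vee\ f_n(y)=x)$ has cliques of size $\aleph_1$ but no cliques of size greater than $\aleph_1$. Let $Z\subseteq\mathbb{R}^{\mathbb{N}}$ be the set of all injective sequences of reals which enumerate a clique of $\mathcal{G}$, and let $=^+\restriction Z$ be the restriction to $Z$ of the equivalence relation $(x_n)=^+(y_n)\iff\{x_n:n\in\mathbb{N}\}=\{y_n:n\in\mathbb{N}\}$. Then $E(\mathrm{Aut}(\mathcal{N}^{\mathrm{BKL}}_2))$ is generically $(=^+\restriction Z)$-ergodic, and hence $E(\mathrm{Aut}(\mathcal{N}^{\mathrm{BKL}}_2))\not\leq_B\ (=^+\restriction Z)$.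
   Context: $\mathcal{L}_2$ is the language with countably many binary relation symbols $R_0,R_1,\dots$ and countably many binary function symbols $f_0,f_1,\dots$ (distinct from the functions $f_n$ above). $\mathcal{N}^{\mathrm{BKL}}_2$ is the (unique up to isomorphism, constructed by Baldwin–Koerwien–Laskowski) countable ultrahomogeneous $\mathcal{L}_2$-structure with domain $\mathbb{N}$ such that: (1) the substructure generated by any finite set is finite; (2) the $R_j$ partition $\mathbb{N}^2$; (3) if $R_j(a_1,a_2)$ then $f_i(a_1,a_2)=a_1$ for all $i>j$; (4) for every 3-element $A\subseteq\mathbb{N}$ there is $a\in A$ in the substructure generated by $A\setminus\{a\}$; (5) every finite $\mathcal{L}_2$-structure satisfying (1)–(4) embeds into it. For $P\leq\mathrm{Sym}(\mathbb{N})$ closed, $E(P)$ is the orbit equivalence relation of the action of $P$ on $\mathbb{R}^{\mathbb{N}}$ given by $(gx)(a)=x(g^{-1}(a))$. $E$ on $X$ is generically $F$-ergodic ($F$ on $Y$) if every Baire-measurable map $f:X\to Y$ with $x\,E\,x'\Rightarrow f(x)\,F\,f(x')$ maps a comeager subset of $X$ into a single $F$-class. $\leq_B$ denotes Borel reducibility. *)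

theory Defs
  imports "HOL-Analysis.Analysis"
begin

definition fgraph :: "(nat \<Rightarrow> real \<Rightarrow> real) \<Rightarrow> real \<Rightarrow> real \<Rightarrow> bool" where
  "fgraph f x y \<longleftrightarrow> (\<exists>n. f n x = y \<or> f n y = x)"

definition is_clique :: "('a \<Rightarrow> 'a \<Rightarrow> bool) \<Rightarrow> 'a set \<Rightarrow> bool" where
  "is_clique G C \<longleftrightarrow> (\<forall>x\<in>C. \<forall>y\<in>C. x \<noteq> y \<longrightarrow> G x y)"

definition clique_seqs :: "(real \<Rightarrow> real \<Rightarrow> bool) \<Rightarrow> (nat \<Rightarrow> real) set" where
  "clique_seqs G = {x. inj x \<and> is_clique G (range x)}"

definition eq_plus_on :: "(nat \<Rightarrow> real) set \<Rightarrow> (nat \<Rightarrow> real) \<Rightarrow> (nat \<Rightarrow> real) \<Rightarrow> bool" where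
  "eq_plus_on Z x y \<longleftrightarrow> x \<in> Z \<and> y \<in> Z \<and> range x = range y"

inductive_set gen :: "(nat \<Rightarrow> 'a \<Rightarrow> 'a \<Rightarrow> 'a) \<Rightarrow> 'a set \<Rightarrow> 'a set" for F A where
  base: "a \<in> A \<Longrightarrow> a \<in> gen F A"
| step: "a \<in> gen F A \<Longrightarrow> b \<in> gen F A \<Longrightarrow> F i a b \<in> gen F A"

definition L2_axioms :: "'a set \<Rightarrow> (nat \<Rightarrow> 'a \<Rightarrow> 'a \<Rightarrow> bool) \<Rightarrow> (nat \<Rightarrow> 'a \<Rightarrow> 'a \<Rightarrow> 'a) \<Rightarrow> bool" where
  "L2_axioms D R F \<longleftrightarrow>
     (\<forall>i. \<forall>a\<in>D. \<forall>b\<in>D. F i a b \<in> D) \<and>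
     (\<forall>A. A \<subseteq> D \<and> finite A \<longrightarrow> finite (gen F A)) \<and>
     (\<forall>a\<in>D. \<forall>b\<in>D. \<exists>!j. R j a b) \<and>
     (\<forall>a\<in>D. \<forall>b\<in>D. \<forall>j i. R j a b \<and> j < i \<longrightarrow> F i a b = a) \<and>
     (\<forall>A. A \<subseteq> D \<and> card A = 3 \<longrightarrow> (\<exists>a\<in>A. a \<in> gen F (A - {a})))"

definition Aut :: "(nat \<Rightarrow> nat \<Rightarrow> nat \<Rightarrow> bool) \<Rightarrow> (nat \<Rightarrow> nat \<Rightarrow> nat \<Rightarrow> nat) \<Rightarrow> (nat \<Rightarrow> nat) set" where
  "Aut R F = {g. bij g \<and> (\<forall>j a b. R j a b \<longleftrightarrow> R j (g a) (g b)) \<and>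
                     (\<forall>i a b. g (F i a b) = F i (g a) (g b))}"

definition ultrahomogeneous :: "(nat \<Rightarrow> nat \<Rightarrow> nat \<Rightarrow> bool) \<Rightarrow> (nat \<Rightarrow> nat \<Rightarrow> nat \<Rightarrow> nat) \<Rightarrow> bool" where
  "ultrahomogeneous R F \<longleftrightarrow>
     (\<forall>A0 B0 h. finite A0 \<and> finite B0 \<and> bij_betw h (gen F A0) (gen F B0) \<and>
        (\<forall>j. \<forall>a\<in>gen F A0. \<forall>b\<in>gen F A0. R j a b \<longleftrightarrow> R j (h a) (h b)) \<and>
        (\<forall>i. \<forall>a\<in>gen F A0. \<forall>b\<in>gen F A0. h (F i a b) = F i (h a) (h b))
      \<longrightarrow> (\<exists>g\<in>Aut R F. \<forall>a\<in>gen F A0. g a = h a))"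

text \<open>(5): every finite L2-structure satisfying (1)-(4) embeds. Finite structures are
  represented (up to isomorphism) with a finite carrier D of naturals.\<close>
definition finite_universal :: "(nat \<Rightarrow> nat \<Rightarrow> nat \<Rightarrow> bool) \<Rightarrow> (nat \<Rightarrow> nat \<Rightarrow> nat \<Rightarrow> nat) \<Rightarrow> bool" where
  "finite_universal R F \<longleftrightarrow>
     (\<forall>(D::nat set) R' F'. finite D \<and> L2_axioms D R' F' \<longrightarrow>
        (\<exists>e. inj_on e D \<and>
             (\<forall>j. \<forall>a\<in>D. \<forall>b\<in>D. R' j a b \<longleftrightarrow> R j (e a) (e b)) \<and>
             (\<forall>i. \<forall>a\<in>D. \<forall>b\<in>D. e (F' i a b) = F i (e a) (e b))))"

definition is_BKL2 :: "(nat \<Rightarrow> nat \<Rightarrow> nat \<Rightarrow> bool) \<Rightarrow> (nat \<Rightarrow> nat \<Rightarrow> nat \<Rightarrow> nat) \<Rightarrow> bool" where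
  "is_BKL2 R F \<longleftrightarrow> L2_axioms UNIV R F \<and> finite_universal R F \<and> ultrahomogeneous R F"

definition orbit_eq :: "(nat \<Rightarrow> nat) set \<Rightarrow> (nat \<Rightarrow> real) \<Rightarrow> (nat \<Rightarrow> real) \<Rightarrow> bool" where
  "orbit_eq P x y \<longleftrightarrow> (\<exists>g\<in>P. y = (\<lambda>a. x (inv g a)))"

definition nowhere_dense :: "'a::topological_space set \<Rightarrow> bool" where
  "nowhere_dense S \<longleftrightarrow> interior (closure S) = {}"

definition meager :: "'a::topological_space set \<Rightarrow> bool" where
  "meager S \<longleftrightarrow> (\<exists>N :: nat \<Rightarrow> 'a set. (\<forall>n. nowhere_dense (N n)) \<and> S \<subseteq> (\<Union>n. N n))"

definition comeager :: "'a::topological_space set \<Rightarrow> bool" where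
  "comeager S \<longleftrightarrow> meager (- S)"

definition has_baire_property :: "'a::topological_space set \<Rightarrow> bool" where
  "has_baire_property S \<longleftrightarrow> (\<exists>U. open U \<and> meager ((S - U) \<union> (U - S)))"

definition baire_measurable :: "('a::topological_space \<Rightarrow> 'b::topological_space) \<Rightarrow> bool" where
  "baire_measurable f \<longleftrightarrow> (\<forall>U. open U \<longrightarrow> has_baire_property (f -` U))"

text \<open>E on X = R^N is generically F-ergodic, F an equivalence relation on Y \<subseteq> R^N
  (with the subspace topology).\<close>
definition generically_ergodic ::
  "((nat \<Rightarrow> real) \<Rightarrow> (nat \<Rightarrow> real) \<Rightarrow> bool) \<Rightarrow> (nat \<Rightarrow> real) set \<Rightarrow>
   ((nat \<Rightarrow> real) \<Rightarrow> (nat \<Rightarrow> real) \<Rightarrow> bool) \<Rightarrow> bool" where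
  "generically_ergodic E Y Fr \<longleftrightarrow>
     (\<forall>f. (\<forall>x. f x \<in> Y) \<and> baire_measurable f \<and> (\<forall>x x'. E x x' \<longrightarrow> Fr (f x) (f x'))
        \<longrightarrow> (\<exists>C. comeager C \<and> (\<forall>x\<in>C. \<forall>y\<in>C. Fr (f x) (f y))))"

definition borel_reducible ::
  "((nat \<Rightarrow> real) \<Rightarrow> (nat \<Rightarrow> real) \<Rightarrow> bool) \<Rightarrow> (nat \<Rightarrow> real) set \<Rightarrow>
   ((nat \<Rightarrow> real) \<Rightarrow> (nat \<Rightarrow> real) \<Rightarrow> bool) \<Rightarrow> bool" where
  "borel_reducible E Y Fr \<longleftrightarrow>
     (\<exists>f. f \<in> borel_measurable borel \<and> (\<forall>x. f x \<in> Y) \<and> (\<forall>x y. E x y \<longleftrightarrow> Fr (f x) (f y)))"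

end

theory Submission
  imports Defs
begin

text \<open>
  Restrict to a comeager set on which all maps involved are continuous, and let \<open>f\<close> be an invariant
  map. A back-and-forth argument shows that every entry of \<open>f x\<close> appears, after moving \<open>x\<close> by an
  automorphism, as an entry invariant under the stabilizer of a finite substructure \<open>A\<close>; such an entry
  depends only on the restriction of \<open>x\<close> to \<open>A\<close>. The structure has free amalgamation of pairs: a
  mixed pair can be made to generate the whole amalgam. Hence \<open>A\<close> has a disjoint copy \<open>B\<close>, and the
  corresponding entry computed from \<open>x\<close> on \<open>B\<close> lies in the same clique. So one entry is obtained from
  the other by some function of the graph, although the restrictions to \<open>A\<close> and \<open>B\<close> are
  independent; this forces the entry to be locally constant. As generic points have dense orbits,
  the range of \<open>f\<close> is generically constant.
\<close>

section \<open>Baire category\<close>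

text \<open>The obstacle is that a Baire measurable map is continuous only on a comeager set
  \<open>C\<close>, that intersections of uncountably many translates of a comeager set need not be
  comeager, and that a back-and-forth limit may be any automorphism. Hence two devices: a countable
  subgroup \<open>Q\<close>, dense for agreement on finite sets, under which \<open>C\<close> is
  invariant; and a presentation of \<open>C\<close> as an intersection of open sets
  \<open>V n\<close>, so that a limit is steered into \<open>C\<close> one \<open>V n\<close> at a
  time. Countability of the family of functions enters through Baire category: equality or adjacency
  of two entries splits the generic part of an open set into countably many relatively closed
  pieces, so one fixed function works on a smaller open set. An identity between a quantity read off
  \<open>A\<close> and one read off \<open>B\<close> then forces constancy, because two prescribed
  nearby values can be imposed on one point, one through \<open>A\<close> and the other through
  \<open>B\<close>. Dependence on \<open>A\<close> alone is used in the form of invariance under the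
  elements of \<open>Q\<close> fixing \<open>A\<close>, together with continuity on
  \<open>C\<close>.\<close>

lemma closed_diff_interior_nowhere_dense: "closed K \<Longrightarrow> nowhere_dense (K - interior K)"
proof -
  assume K: "closed K"
  have "closed (K - interior K)" using K by (simp add: closed_Diff)
  moreover have "interior (K - interior K) = {}"
  proof -
    have "interior (K - interior K) \<subseteq> interior K" by (simp add: interior_mono)
    then show ?thesis using interior_subset[of "K - interior K"] by blast
  qed
  ultimately show ?thesis by (simp add: nowhere_dense_def closure_closed)
qed

lemma nowhere_dense_imp_meager: "nowhere_dense S \<Longrightarrow> meager S"
  unfolding meager_def by (rule exI[of _ "\<lambda>_. S"]) auto

lemma meager_empty: "meager {}"
  by (rule nowhere_dense_imp_meager) (simp add: nowhere_dense_def)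

lemma meager_subset: "meager S \<Longrightarrow> T \<subseteq> S \<Longrightarrow> meager T"
  unfolding meager_def by (meson subset_trans)

lemma meager_UN:
  fixes S :: "nat \<Rightarrow> 'a::topological_space set"
  assumes "\<And>n. meager (S n)"
  shows "meager (\<Union>n. S n)"
proof -
  have "\<forall>n. \<exists>N :: nat \<Rightarrow> 'a set. (\<forall>k. nowhere_dense (N k)) \<and> S n \<subseteq> (\<Union>k. N k)"
    using assms unfolding meager_def ..
  from choice[OF this] obtain N :: "nat \<Rightarrow> nat \<Rightarrow> 'a set"
    where "\<forall>n. (\<forall>k. nowhere_dense (N n k)) \<and> S n \<subseteq> (\<Union>k. N n k)" ..
  then have N: "\<And>n k. nowhere_dense (N n k)" "\<And>n. S n \<subseteq> (\<Union>k. N n k)" by simp_all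
  have "(\<Union>n. S n) \<subseteq> (\<Union>m. N (fst (prod_decode m)) (snd (prod_decode m)))"
  proof
    fix x assume "x \<in> (\<Union>n. S n)"
    then obtain n k where "x \<in> N n k" using N(2) by blast
    then show "x \<in> (\<Union>m. N (fst (prod_decode m)) (snd (prod_decode m)))"
      by (intro UN_I[of "prod_encode (n, k)"]) auto
  qed
  then show ?thesis unfolding meager_def
    by (intro exI[of _ "\<lambda>m. N (fst (prod_decode m)) (snd (prod_decode m))"] conjI allI N(1))
qed

lemma meager_countable_UN:
  fixes S :: "'i \<Rightarrow> 'a::topological_space set"
  assumes "countable I" "\<And>i. i \<in> I \<Longrightarrow> meager (S i)"
  shows "meager (\<Union>i\<in>I. S i)"
proof (cases "I = {}")
  case True then show ?thesis by (simp add: meager_empty)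
next
  case False
  have "(\<Union>n. S (from_nat_into I n)) = (\<Union>i\<in>range (from_nat_into I). S i)" by simp
  then have "(\<Union>i\<in>I. S i) = (\<Union>n. S (from_nat_into I n))"
    unfolding range_from_nat_into[OF False assms(1)] ..
  then show ?thesis using meager_UN[of "\<lambda>n. S (from_nat_into I n)"] assms False
    by (simp add: from_nat_into)
qed

lemma meager_Un: "meager S \<Longrightarrow> meager T \<Longrightarrow> meager (S \<union> T)"
  using meager_countable_UN[of "{S, T}" "\<lambda>x. x"] by auto

lemma has_baire_property_open: "open U \<Longrightarrow> has_baire_property U"
  unfolding has_baire_property_def by (rule exI[of _ U]) (simp add: meager_empty)

lemma has_baire_property_Compl:
  assumes "has_baire_property S"
  shows "has_baire_property (- S)"
proof -
  obtain U where U: "open U" "meager ((S - U) \<union> (U - S))"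
    using assms unfolding has_baire_property_def by auto
  have "meager ((- U) - interior (- U))"
    using U(1) by (intro nowhere_dense_imp_meager closed_diff_interior_nowhere_dense) auto
  from meager_Un[OF U(2) this]
  have "meager ((- S - interior (- U)) \<union> (interior (- U) - - S))"
    by (rule meager_subset) (use interior_subset[of "- U"] in auto)
  then show ?thesis unfolding has_baire_property_def using open_interior by blast
qed

lemma has_baire_property_UN:
  fixes S :: "nat \<Rightarrow> 'a::topological_space set"
  assumes "\<And>n. has_baire_property (S n)"
  shows "has_baire_property (\<Union>n. S n)"
proof -
  obtain U where U: "\<And>n. open (U n)" "\<And>n. meager ((S n - U n) \<union> (U n - S n))"
    using assms unfolding has_baire_property_def by metis
  have "meager (((\<Union>n. S n) - (\<Union>n. U n)) \<union> ((\<Union>n. U n) - (\<Union>n. S n)))"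
    by (rule meager_subset[OF meager_UN[of "\<lambda>n. (S n - U n) \<union> (U n - S n)", OF U(2)]]) auto
  then show ?thesis unfolding has_baire_property_def using U(1) by blast
qed

lemma has_baire_property_vimage_borel:
  assumes f: "baire_measurable f" and "B \<in> sets borel"
  shows "has_baire_property (f -` B)"
proof -
  have "B \<in> sigma_sets UNIV {S. open S}"
    using assms(2) by (simp add: borel_def)
  then show ?thesis
  proof induction
    case (Basic a)
    then show ?case using f by (simp add: baire_measurable_def)
  next
    case Empty
    then show ?case by (simp add: has_baire_property_open)
  next
    case (Compl a)
    then show ?case using has_baire_property_Compl by (simp add: vimage_Diff Compl_eq_Diff_UNIV)
  next
    case (Union a)
    then show ?case using has_baire_property_UN[of "\<lambda>n. f -` a n"] by (simp add: vimage_UN)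
  qed
qed

lemma baire_measurable_id: "baire_measurable (\<lambda>x. x)"
  by (simp add: baire_measurable_def has_baire_property_open)

lemma baire_measurable_borel_comp:
  assumes "baire_measurable f" "g \<in> borel_measurable borel"
  shows "baire_measurable (\<lambda>x. g (f x))"
  unfolding baire_measurable_def
proof (intro allI impI)
  fix U assume "open (U :: 'c set)"
  then have "g -` U \<in> sets borel"
    using assms(2) measurable_sets[of g borel borel U] by simp
  from has_baire_property_vimage_borel[OF assms(1) this]
  show "has_baire_property ((\<lambda>x. g (f x)) -` U)" by (simp add: vimage_def)
qed

text \<open>Off countably many meager errors, the preimage of each basic open set coincides with an
  open set. Countability of \<open>I\<close> lets a single \<open>C\<close> serve all the
  maps.\<close>

lemma baire_measurable_continuous_comeager:
  fixes \<phi> :: "'i \<Rightarrow> 'a::topological_space \<Rightarrow> 'b::second_countable_topology"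
  assumes I: "countable I" and \<phi>: "\<And>i. i \<in> I \<Longrightarrow> baire_measurable (\<phi> i)"
  shows "\<exists>C. comeager C \<and> (\<forall>i\<in>I. continuous_on C (\<phi> i))"
proof -
  obtain B :: "'b set set" where B: "countable B" "topological_basis B"
    using ex_countable_basis by auto
  have "\<exists>U. open U \<and> meager ((\<phi> i -` b - U) \<union> (U - \<phi> i -` b))" if "i \<in> I" "b \<in> B" for i b
    using \<phi>[OF that(1)] topological_basis_open[OF B(2) that(2)]
    by (simp add: baire_measurable_def has_baire_property_def)
  then obtain U where U: "\<And>i b. i \<in> I \<Longrightarrow> b \<in> B \<Longrightarrow> open (U i b)"
    "\<And>i b. i \<in> I \<Longrightarrow> b \<in> B \<Longrightarrow> meager ((\<phi> i -` b - U i b) \<union> (U i b - \<phi> i -` b))"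
    by metis
  define M where "M = (\<Union>(i, b)\<in>I \<times> B. (\<phi> i -` b - U i b) \<union> (U i b - \<phi> i -` b))"
  have "meager M"
    unfolding M_def by (rule meager_countable_UN) (use I B(1) U(2) in auto)
  moreover have "continuous_on (- M) (\<phi> i)" if i: "i \<in> I" for i
    unfolding continuous_on_open_invariant
  proof (intro allI impI)
    fix V :: "'b set" assume "open V"
    then obtain B' where B': "B' \<subseteq> B" "\<Union>B' = V" using B(2) by (meson topological_basis_def)
    show "\<exists>A. open A \<and> A \<inter> - M = \<phi> i -` V \<inter> - M"
    proof (intro exI conjI)
      show "open (\<Union>b\<in>B'. U i b)" using B'(1) U(1) i by blast
      have "U i b \<inter> - M = \<phi> i -` b \<inter> - M" if "b \<in> B'" for b
        using that B'(1) i unfolding M_def by fastforce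
      then show "(\<Union>b\<in>B'. U i b) \<inter> - M = \<phi> i -` V \<inter> - M"
        using B'(2) by blast
    qed
  qed
  ultimately show ?thesis
    unfolding comeager_def by (intro exI[of _ "- M"]) simp
qed

section \<open>Comeager sets and the Baire category theorem\<close>

lemma comeagerE:
  assumes "comeager C"
  obtains V :: "nat \<Rightarrow> 'a::topological_space set"
  where "\<And>n. open (V n)" "\<And>n. closure (V n) = UNIV" "(\<Inter>n. V n) \<subseteq> C"
proof -
  obtain N :: "nat \<Rightarrow> 'a set" where N: "\<And>n. nowhere_dense (N n)" "- C \<subseteq> (\<Union>n. N n)"
    using assms unfolding comeager_def meager_def by blast
  show ?thesis
  proof
    show "open (- closure (N n))" for n by auto
    show "closure (- closure (N n)) = UNIV" for n
      using N(1)[of n] unfolding nowhere_dense_def closure_complement by simp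
    show "(\<Inter>n. - closure (N n)) \<subseteq> C"
    proof
      fix x assume "x \<in> (\<Inter>n. - closure (N n))"
      then have "x \<notin> N n" for n using closure_subset[of "N n"] by blast
      then show "x \<in> C" using N(2) by blast
    qed
  qed
qed

lemma comeager_open_dense:
  assumes "open V" "closure V = UNIV"
  shows "comeager V"
proof -
  have "closure (- V) = - V" using assms(1) by (simp add: closed_Compl closure_closed)
  moreover have "interior (- V) = {}" unfolding interior_complement assms(2) by simp
  ultimately show ?thesis
    unfolding comeager_def by (intro nowhere_dense_imp_meager) (simp add: nowhere_dense_def)
qed

lemma comeager_openI:
  assumes "open S" "\<And>W. open W \<Longrightarrow> W \<noteq> {} \<Longrightarrow> W \<inter> S \<noteq> {}"
  shows "comeager S"
proof (rule comeager_open_dense[OF assms(1)])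
  have "- closure S \<inter> S = {}" using closure_subset[of S] by blast
  then have "- closure S = {}" using assms(2)[of "- closure S"] by auto
  then show "closure S = UNIV" by blast
qed

lemma comeager_INT:
  assumes "countable I" "\<And>i. i \<in> I \<Longrightarrow> comeager (C i)"
  shows "comeager (\<Inter>i\<in>I. C i)"
  using meager_countable_UN[of I "\<lambda>i. - C i"] assms unfolding comeager_def Compl_INT by blast

lemma comeager_Int: "comeager C \<Longrightarrow> comeager D \<Longrightarrow> comeager (C \<inter> D)"
  using meager_Un[of "- C" "- D"] by (simp add: comeager_def)

lemma comeager_meets_open:
  fixes C :: "'a::complete_space set"
  assumes "comeager C" "open W" "W \<noteq> {}"
  shows "W \<inter> C \<noteq> {}"
proof -
  obtain V :: "nat \<Rightarrow> 'a set" where V: "\<And>n. open (V n)" "\<And>n. closure (V n) = UNIV" "(\<Inter>n. V n) \<subseteq> C"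
    using comeagerE[OF assms(1)] by blast
  have "(euclidean :: 'a topology) closure_of \<Inter>(range V) = topspace euclidean"
  proof (rule Baire_category)
    show "completely_metrizable_space (euclidean :: 'a topology) \<or>
        locally_compact_space (euclidean :: 'a topology) \<and> regular_space (euclidean :: 'a topology)"
      using completely_metrizable_space_euclidean by (rule disjI1)
    show "openin euclidean T \<and> euclidean closure_of T = topspace euclidean" if "T \<in> range V" for T
      using that V(1,2) by auto
  qed simp
  then have "closure (\<Inter>n. V n) = UNIV" by simp
  then have "closure C = UNIV" using closure_mono[OF V(3)] by auto
  then show ?thesis using open_Int_closure_eq_empty[OF assms(2), of C] assms(3) by simp
qed

text \<open>A closed set exceeds its interior by a nowhere dense set only, so a generic point of
  \<open>W\<close> lying in some \<open>K i\<close> already lies in its interior. This turns a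
  witness depending on the point into one fixed witness on an open set.\<close>

lemma comeager_closed_cover:
  fixes C :: "'a::complete_space set"
  assumes C: "comeager C" and W: "open W" "W \<noteq> {}" and I: "countable I"
    and T: "\<And>i. i \<in> I \<Longrightarrow> closedin (top_of_set C) (T i)"
    and cover: "W \<inter> C \<subseteq> (\<Union>i\<in>I. T i)"
  obtains i W' where "i \<in> I" "open W'" "W' \<noteq> {}" "W' \<subseteq> W" "W' \<inter> C \<subseteq> T i"
proof -
  have "\<forall>i. \<exists>K. i \<in> I \<longrightarrow> closed K \<and> T i = C \<inter> K"
    using T unfolding closedin_closed by blast
  from choice[OF this] obtain K where "\<forall>i. i \<in> I \<longrightarrow> closed (K i) \<and> T i = C \<inter> K i" ..
  then have K: "\<And>i. i \<in> I \<Longrightarrow> closed (K i)" "\<And>i. i \<in> I \<Longrightarrow> T i = C \<inter> K i" by simp_all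
  have "\<exists>i\<in>I. interior (K i) \<inter> W \<noteq> {}"
  proof (rule ccontr)
    assume "\<not> ?thesis"
    then have e: "interior (K i) \<inter> W = {}" if "i \<in> I" for i using that by auto
    have "meager (\<Union>i\<in>I. K i - interior (K i))"
      by (rule meager_countable_UN[OF I])
        (simp add: K(1) closed_diff_interior_nowhere_dense nowhere_dense_imp_meager)
    then have "comeager (- (\<Union>i\<in>I. K i - interior (K i)))"
      unfolding comeager_def double_complement .
    from comeager_meets_open[OF comeager_Int[OF C this] W]
    obtain x where x: "x \<in> W" "x \<in> C" "x \<notin> (\<Union>i\<in>I. K i - interior (K i))" by blast
    then obtain i where i: "i \<in> I" "x \<in> T i" using cover by blast
    then have "x \<in> K i" using K(2) by simp
    then have "x \<in> interior (K i)" using x(3) i(1) by blast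
    then show False using e[OF i(1)] x(1) by blast
  qed
  then obtain i where i: "i \<in> I" "interior (K i) \<inter> W \<noteq> {}" by auto
  show ?thesis
  proof (rule that[OF i(1) _ i(2)])
    show "open (interior (K i) \<inter> W)" using W(1) by auto
    show "interior (K i) \<inter> W \<inter> C \<subseteq> T i"
      unfolding K(2)[OF i(1)] using interior_subset[of "K i"] by blast
  qed blast
qed

section \<open>Free amalgamation and automorphisms\<close>

lemma gen_superset: "A \<subseteq> gen F A"
  by (auto intro: gen.base)

lemma gen_subset_closed:
  assumes "A \<subseteq> D" "\<And>i a b. a \<in> D \<Longrightarrow> b \<in> D \<Longrightarrow> F i a b \<in> D"
  shows "gen F A \<subseteq> D"
proof
  fix x assume "x \<in> gen F A"
  then show "x \<in> D" by induction (use assms in auto)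
qed

lemma gen_closed_eq:
  assumes "\<And>i a b. a \<in> D \<Longrightarrow> b \<in> D \<Longrightarrow> F i a b \<in> D"
  shows "gen F D = D"
  using gen_subset_closed[of D D F] assms gen_superset[of D F] by blast

lemma gen_image:
  assumes "S \<subseteq> D" "\<And>i a b. a \<in> D \<Longrightarrow> b \<in> D \<Longrightarrow> F i a b \<in> D"
    and "\<And>i a b. a \<in> D \<Longrightarrow> b \<in> D \<Longrightarrow> h (F i a b) = F' i (h a) (h b)"
    and "x \<in> gen F S"
  shows "h x \<in> gen F' (h ` S)"
proof -
  have "x \<in> D \<and> h x \<in> gen F' (h ` S)"
    using assms(4)
  proof induction
    case (base a)
    then show ?case using assms(1) by (auto intro: gen.base)
  next
    case (step a b i)
    then show ?case using assms(2,3) gen.step[of "h a" F' "h ` S" "h b" i] by simp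
  qed
  then show ?thesis ..
qed

definition closed_under :: "(nat \<Rightarrow> 'a \<Rightarrow> 'a \<Rightarrow> 'a) \<Rightarrow> 'a set \<Rightarrow> bool" where
  "closed_under F D \<longleftrightarrow> (\<forall>i. \<forall>a\<in>D. \<forall>b\<in>D. F i a b \<in> D)"

lemma closed_underD: "closed_under F D \<Longrightarrow> a \<in> D \<Longrightarrow> b \<in> D \<Longrightarrow> F i a b \<in> D"
  by (simp add: closed_under_def)

lemma closed_under_gen: "closed_under F (gen F A)"
  by (simp add: closed_under_def gen.step)

lemma gen_of_closed_under: "closed_under F D \<Longrightarrow> gen F D = D"
  by (rule gen_closed_eq) (rule closed_underD)

text \<open>Two copies of \<open>D\<close> are glued along \<open>A\<close>. Every pair that meets both copies outside \<open>A\<close>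
  generates the whole amalgam, which makes all three-element sets across the copies dependent.\<close>

lemma amalgam_exists:
  fixes R :: "nat \<Rightarrow> nat \<Rightarrow> nat \<Rightarrow> bool"
  assumes ax: "L2_axioms UNIV R F" and D: "finite D" "closed_under F D"
    and A: "A \<subseteq> D" "closed_under F A"
  obtains K :: "nat set" and R' F' and p q :: "nat \<Rightarrow> nat"
  where "finite K" "L2_axioms K R' F'"
    "p ` D \<subseteq> K" "q ` D \<subseteq> K" "inj_on p D" "inj_on q D" "p ` D \<inter> q ` D \<subseteq> p ` A"
    "\<And>a. a \<in> A \<Longrightarrow> p a = q a"
    "\<And>j a b. a \<in> D \<Longrightarrow> b \<in> D \<Longrightarrow> R' j (p a) (p b) = R j a b"
    "\<And>j a b. a \<in> D \<Longrightarrow> b \<in> D \<Longrightarrow> R' j (q a) (q b) = R j a b"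
    "\<And>i a b. a \<in> D \<Longrightarrow> b \<in> D \<Longrightarrow> F' i (p a) (p b) = p (F i a b)"
    "\<And>i a b. a \<in> D \<Longrightarrow> b \<in> D \<Longrightarrow> F' i (q a) (q b) = q (F i a b)"
proof -
  \<comment> \<open>Points of \<open>A\<close> are even in both copies, the other points of the
    second copy are odd. Halving recovers the original point from either copy.\<close>
  define p :: "nat \<Rightarrow> nat" where "p d = 2 * d" for d
  define q :: "nat \<Rightarrow> nat" where "q d = (if d \<in> A then 2 * d else 2 * d + 1)" for d
  define K where "K = p ` D \<union> q ` D"
  have finK: "finite K" unfolding K_def using D(1) by simp
  obtain e :: "nat \<Rightarrow> nat" and N where e: "K = e ` {i. i < N}"
    using finite_imp_nat_seg_image_inj_on[OF finK] by blast
  \<comment> \<open>A mixed pair gets the relation with index \<open>N\<close>, a bound for the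
    enumeration \<open>e\<close> of \<open>K\<close>. Axiom (3) then leaves the functions below
    \<open>N\<close> unconstrained on such a pair, and these output all of \<open>K\<close>; from
    \<open>N\<close> on the value is the first argument.\<close>
  define R' where "R' j u v =
    (if u \<in> p ` D \<and> v \<in> p ` D \<or> u \<in> q ` D \<and> v \<in> q ` D then R j (u div 2) (v div 2) else j = N)" for j u v
  define F' where "F' i u v =
    (if u \<in> p ` D \<and> v \<in> p ` D then p (F i (u div 2) (v div 2))
     else if u \<in> q ` D \<and> v \<in> q ` D then q (F i (u div 2) (v div 2))
     else if i < N then e i else u)" for i u v
  have pdiv [simp]: "p d div 2 = d" for d by (simp add: p_def)
  have qdiv [simp]: "q d div 2 = d" for d by (simp add: q_def)
  have pq: "p a = q a" if "a \<in> A" for a using that by (simp add: p_def q_def)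
  have qp: "a \<in> A" if "q a \<in> p ` D" for a using that by (auto simp: p_def q_def split: if_splits) presburger
  have Rp: "R' j (p a) (p b) = R j a b" and Rq: "R' j (q a) (q b) = R j a b"
    and Fp: "F' i (p a) (p b) = p (F i a b)" if "a \<in> D" "b \<in> D" for i j a b
    using that by (simp_all add: R'_def F'_def)
  have Fq: "F' i (q a) (q b) = q (F i a b)" if ab: "a \<in> D" "b \<in> D" for i a b
  \<comment> \<open>\<open>F'\<close> tries the first copy first, so pairs lying in both copies need
    a check. They come from \<open>A\<close>, which is closed and on which \<open>p\<close> and
    \<open>q\<close> agree.\<close>
  proof (cases "q a \<in> p ` D \<and> q b \<in> p ` D")
    case True
    then have "F i a b \<in> A" using qp closed_underD[OF A(2)] by blast
    then have "p (F i a b) = q (F i a b)" by (rule pq)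
    then show ?thesis using True by (simp add: F'_def)
  next
    case False
    then have "F' i (q a) (q b) = q (F i (q a div 2) (q b div 2))" using ab unfolding F'_def by auto
    then show ?thesis by simp
  qed
  have mixed: "F' i u v = (if i < N then e i else u)" "R' j u v = (j = N)"
    if "\<not> (u \<in> p ` D \<and> v \<in> p ` D)" "\<not> (u \<in> q ` D \<and> v \<in> q ` D)" for i j u v
    using that unfolding F'_def R'_def by (simp_all only: if_False simp_thms)
  have Dcl: "F i a b \<in> D" if "a \<in> D" "b \<in> D" for i a b using closed_underD[OF D(2)] that by blast
  have K_cases: "(\<exists>a\<in>D. \<exists>b\<in>D. u = p a \<and> v = p b) \<or> (\<exists>a\<in>D. \<exists>b\<in>D. u = q a \<and> v = q b)
      \<or> (\<not> (u \<in> p ` D \<and> v \<in> p ` D) \<and> \<not> (u \<in> q ` D \<and> v \<in> q ` D))" for u v by blast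
  have F'K: "F' i u v \<in> K" if "u \<in> K" "v \<in> K" for i u v
    using K_cases[of u v]
  proof (elim disjE)
    assume "\<exists>a\<in>D. \<exists>b\<in>D. u = p a \<and> v = p b"
    then show ?thesis using Fp Dcl unfolding K_def by auto
  next
    assume "\<exists>a\<in>D. \<exists>b\<in>D. u = q a \<and> v = q b"
    then show ?thesis using Fq Dcl unfolding K_def by auto
  next
    assume "\<not> (u \<in> p ` D \<and> v \<in> p ` D) \<and> \<not> (u \<in> q ` D \<and> v \<in> q ` D)"
    then show ?thesis using mixed(1)[of u v i] e that(1) by auto
  qed
  have exR: "\<exists>!j. R j a b" for a b using ax by (simp add: L2_axioms_def)
  have axF: "F i a b = a" if "R j a b" "j < i" for i j a b
    using ax that unfolding L2_axioms_def by blast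
  have ax3: "\<exists>a\<in>S. a \<in> gen F (S - {a})" if "card S = 3" for S
    using ax that unfolding L2_axioms_def by blast
  have copy3: "\<exists>u\<in>S. u \<in> gen F' (S - {u})"
    if S: "card S = 3" "S \<subseteq> r ` D" and r: "inj_on r D"
      "\<And>i a b. a \<in> D \<Longrightarrow> b \<in> D \<Longrightarrow> r (F i a b) = F' i (r a) (r b)" for S r
  proof -
    obtain T where T: "T \<subseteq> D" "S = r ` T" using S(2) by (meson subset_imageE)
    have "card T = 3" using S(1) T r(1) by (metis card_image inj_on_subset)
    then obtain a where a: "a \<in> T" "a \<in> gen F (T - {a})" using ax3 by blast
    have "r a \<in> gen F' (r ` (T - {a}))"
      using gen_image[where S = "T - {a}" and D = D and F = F and h = r and F' = F' and x = a]
        Dcl r(2) a(2) T(1) by blast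
    moreover have "r ` (T - {a}) = S - {r a}"
      using T r(1) a(1) by (auto simp: inj_on_def)
    ultimately show ?thesis using a(1) T(2) by auto
  qed
  have "L2_axioms K R' F'"
    unfolding L2_axioms_def
  proof (intro conjI allI ballI impI)
    show "F' i u v \<in> K" if "u \<in> K" "v \<in> K" for i u v using F'K that by blast
    show "finite (gen F' S)" if "S \<subseteq> K \<and> finite S" for S
      using gen_subset_closed[of S K F'] that F'K finite_subset[OF _ finK] by blast
    show "\<exists>!j. R' j u v" if "u \<in> K" "v \<in> K" for u v
    proof -
      have "(\<exists>a b. \<forall>j. R' j u v = R j a b) \<or> (\<forall>j. R' j u v = (j = N))"
        using K_cases[of u v] Rp Rq mixed(2)[of u v] by (elim disjE) blast+
      then show ?thesis
      proof
        assume "\<exists>a b. \<forall>j. R' j u v = R j a b"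
        then obtain a b where "\<forall>j. R' j u v = R j a b" by blast
        then show ?thesis using exR[of a b] by simp
      qed auto
    qed
    show "F' i u v = u" if "u \<in> K" "v \<in> K" "R' j u v \<and> j < i" for u v i j
      using K_cases[of u v]
    proof (elim disjE)
      assume "\<exists>a\<in>D. \<exists>b\<in>D. u = p a \<and> v = p b"
      then show ?thesis using Fp Rp axF that(3) by auto
    next
      assume "\<exists>a\<in>D. \<exists>b\<in>D. u = q a \<and> v = q b"
      then show ?thesis using Fq Rq axF that(3) by auto
    next
      assume "\<not> (u \<in> p ` D \<and> v \<in> p ` D) \<and> \<not> (u \<in> q ` D \<and> v \<in> q ` D)"
      then show ?thesis using mixed[of u v] that(3) by auto
    qed
    show "\<exists>u\<in>S. u \<in> gen F' (S - {u})" if S: "S \<subseteq> K \<and> card S = 3" for S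
    proof (cases "S \<subseteq> p ` D \<or> S \<subseteq> q ` D")
      case True
      then show ?thesis
        using copy3[of S p] copy3[of S q] S Fp Fq by (auto simp: inj_on_def p_def q_def split: if_splits)
    next
      case False
      then obtain u v where u: "u \<in> S" "u \<notin> p ` D" and v: "v \<in> S" "v \<notin> q ` D" by blast
      have "\<exists>w. w \<in> S \<and> w \<notin> {u, v}"
      proof (rule ccontr)
        assume "\<not> ?thesis"
        then have "S \<subseteq> {u, v}" by blast
        then have "card S \<le> card {u, v}" by (rule card_mono[rotated]) simp
        also have "\<dots> \<le> 2" by (simp add: card_insert_if)
        finally show False using S by simp
      qed
      then obtain w where w: "w \<in> S" "w \<noteq> u" "w \<noteq> v" by blast
      then obtain i where i: "i < N" "w = e i" using S e by blast
      then have "F' i u v = w" using mixed(1)[of u v i] u(2) v(2) by simp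
      moreover have "F' i u v \<in> gen F' (S - {w})"
        by (intro gen.step gen.base) (use u v w in auto)
      ultimately show ?thesis using w(1) by auto
    qed
  qed
  moreover have "p ` D \<inter> q ` D \<subseteq> p ` A"
  proof
    fix u assume u: "u \<in> p ` D \<inter> q ` D"
    then obtain d where d: "u = q d" by blast
    then have "d \<in> A" using u qp by blast
    then show "u \<in> p ` A" using d pq[of d] by (metis imageI)
  qed
  moreover have "inj_on p D" by (rule inj_on_inverseI[where g = "\<lambda>d. d div 2"]) simp
  moreover have "inj_on q D" by (rule inj_on_inverseI[where g = "\<lambda>d. d div 2"]) simp
  moreover have "p ` D \<subseteq> K" "q ` D \<subseteq> K" by (simp_all add: K_def)
  ultimately show ?thesis by (intro that[of K R' F' p q] finK Rp Rq Fp Fq pq)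
qed

section \<open>The automorphism group and a countable dense subgroup\<close>

lemma Aut_bij: "g \<in> Aut R F \<Longrightarrow> bij g"
  by (simp add: Aut_def)

lemma Aut_id: "id \<in> Aut R F"
  by (simp add: Aut_def)

lemma Aut_comp: "g \<in> Aut R F \<Longrightarrow> h \<in> Aut R F \<Longrightarrow> g \<circ> h \<in> Aut R F"
  unfolding Aut_def by (auto simp: bij_comp)

lemma Aut_inv:
  assumes "g \<in> Aut R F"
  shows "inv g \<in> Aut R F"
proof -
  have g: "bij g" "\<And>j a b. R j a b = R j (g a) (g b)" "\<And>i a b. g (F i a b) = F i (g a) (g b)"
    using assms unfolding Aut_def by blast+
  have gi: "g (inv g a) = a" for a using g(1) by (simp add: bij_is_surj surj_f_inv_f)
  have "inv g (F i a b) = F i (inv g a) (inv g b)" for i a b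
  proof -
    have "g (F i (inv g a) (inv g b)) = F i a b" by (simp add: g(3) gi)
    then show ?thesis using g(1) by (metis bij_inv_eq_iff)
  qed
  moreover have "R j a b = R j (inv g a) (inv g b)" for j a b
    using g(2)[of j "inv g a" "inv g b"] by (simp add: gi)
  ultimately show ?thesis using g(1) by (simp add: Aut_def bij_imp_bij_inv)
qed

text \<open>Agreement on a finite set follows from agreement on an initial segment, and there are
  only countably many finite lists of values. One automorphism is chosen for each realizable list;
  closing under inverses and finite composition keeps the family countable.\<close>

lemma countable_dense_subgroup:
  "\<exists>Q. countable Q \<and> Q \<subseteq> Aut R F \<and> id \<in> Q \<and> (\<forall>g\<in>Q. \<forall>h\<in>Q. g \<circ> h \<in> Q) \<and> (\<forall>g\<in>Q. inv g \<in> Q) \<and>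
    (\<forall>g\<in>Aut R F. \<forall>E. finite E \<longrightarrow> (\<exists>h\<in>Q. \<forall>a\<in>E. h a = g a))"
proof -
  define c where "c l = (SOME g. g \<in> Aut R F \<and> map g [0..<length l] = l)" for l
  define S0 where "S0 = {c l |l. \<exists>g\<in>Aut R F. map g [0..<length l] = l}"
  define S where "S = S0 \<union> inv ` S0"
  define comp_list :: "(nat \<Rightarrow> nat) list \<Rightarrow> nat \<Rightarrow> nat" where "comp_list l = foldr (\<circ>) l id" for l
  have comp_list_simps: "comp_list [] = id" "comp_list (g # l) = g \<circ> comp_list l" for g l
    by (simp_all only: comp_list_def foldr.simps id_apply o_apply)
  define Q where "Q = comp_list ` lists S"
  have c: "c l \<in> Aut R F \<and> map (c l) [0..<length l] = l" if "\<exists>g\<in>Aut R F. map g [0..<length l] = l" for l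
    using someI_ex[of "\<lambda>g. g \<in> Aut R F \<and> map g [0..<length l] = l"] that unfolding c_def by blast
  then have S0: "S0 \<subseteq> Aut R F" by (auto simp: S0_def)
  have SA: "S \<subseteq> Aut R F" using S0 Aut_inv unfolding S_def by blast
  have "inv (inv g) = g" if "g \<in> S0" for g
    using that S0 Aut_bij inv_inv_eq by blast
  then have Sinv: "inv g \<in> S" if "g \<in> S" for g
    using that unfolding S_def by auto
  have "countable S0" unfolding S0_def by (rule countable_subset[of _ "range c"]) auto
  then have cS: "countable S" by (simp add: S_def)
  have comp_list_comp: "comp_list (l @ l') = comp_list l \<circ> comp_list l'" for l l'
    by (induction l) (simp_all only: comp_list_simps append.simps comp_assoc id_comp)
  have comp_list_Aut: "comp_list l \<in> Aut R F" if "l \<in> lists S" for l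
    using that
  proof induction
    case Nil
    then show ?case unfolding comp_list_simps by (rule Aut_id)
  next
    case (Cons g l)
    then show ?case unfolding comp_list_simps using SA by (blast intro: Aut_comp)
  qed
  have comp_list_inv: "inv (comp_list l) = comp_list (map inv (rev l))" if "l \<in> lists S" for l
    using that
  proof induction
    case Nil
    then show ?case by (simp add: comp_list_simps)
  next
    case (Cons g l)
    then have "bij g" "bij (comp_list l)" using SA comp_list_Aut Aut_bij by blast+
    then have "inv (comp_list (g # l)) = comp_list (map inv (rev l)) \<circ> inv g"
      using Cons.IH by (simp only: comp_list_simps o_inv_distrib)
    then show ?case by (simp only: comp_list_comp comp_list_simps rev.simps map_append list.map comp_id)
  qed
  show ?thesis
  proof (intro exI[of _ Q] conjI ballI allI impI)
    show "countable Q" unfolding Q_def by (intro countable_image countable_lists cS)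
    show "Q \<subseteq> Aut R F" unfolding Q_def using comp_list_Aut by blast
    show "id \<in> Q" unfolding Q_def by (rule image_eqI[of _ _ "[]"]) (simp_all add: comp_list_simps)
    show "g \<circ> h \<in> Q" if gh: "g \<in> Q" "h \<in> Q" for g h
    proof -
      obtain l l' where "l \<in> lists S" "l' \<in> lists S" "g = comp_list l" "h = comp_list l'"
        using gh unfolding Q_def by blast
      then show ?thesis unfolding Q_def by (intro image_eqI[of _ _ "l @ l'"]) (simp_all only: comp_list_comp append_in_lists_conv)
    qed
    show "inv g \<in> Q" if g: "g \<in> Q" for g
    proof -
      obtain l where l: "l \<in> lists S" "g = comp_list l" using g unfolding Q_def by blast
      then have "map inv (rev l) \<in> lists S" using Sinv by (auto simp: in_lists_conv_set)
      then show ?thesis unfolding Q_def using comp_list_inv[OF l(1)] l(2) by (intro image_eqI) auto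
    qed
    show "\<exists>h\<in>Q. \<forall>a\<in>E. h a = g a" if g: "g \<in> Aut R F" and E: "finite E" for g E
    proof -
      obtain n where n: "\<forall>a\<in>E. a < n" using finite_nat_set_iff_bounded E by blast
      define l where "l = map g [0..<n]"
      have l: "\<exists>g\<in>Aut R F. map g [0..<length l] = l" using g by (auto simp: l_def)
      then have "c l \<in> S" unfolding S_def S0_def by blast
      then have "c l \<in> Q" unfolding Q_def by (intro image_eqI[of _ _ "[c l]"]) (simp_all add: comp_list_simps)
      moreover have "map (c l) [0..<n] = map g [0..<n]" using c[OF l] by (simp add: l_def)
      then have "\<forall>a\<in>E. c l a = g a" using n by simp
      ultimately show ?thesis by blast
    qed
  qed
qed

section \<open>Homogeneity and amalgamation inside the structure\<close>

locale BKL_structure =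
  fixes R :: "nat \<Rightarrow> nat \<Rightarrow> nat \<Rightarrow> bool" and F :: "nat \<Rightarrow> nat \<Rightarrow> nat \<Rightarrow> nat"
  assumes BKL: "is_BKL2 R F"
begin

lemma L2: "L2_axioms UNIV R F"
  using BKL by (simp add: is_BKL2_def)

lemma finite_gen: "finite A \<Longrightarrow> finite (gen F A)"
  using L2 by (simp add: L2_axioms_def)

lemma finite_closed_superset:
  assumes "finite A"
  obtains D where "finite D" "closed_under F D" "A \<subseteq> D"
  using that finite_gen[OF assms] closed_under_gen gen_superset by metis

lemma extend_partial_automorphism:
  assumes D: "finite D" "closed_under F D" and h: "inj_on h D"
    and hR: "\<And>j a b. a \<in> D \<Longrightarrow> b \<in> D \<Longrightarrow> R j (h a) (h b) = R j a b"
    and hF: "\<And>i a b. a \<in> D \<Longrightarrow> b \<in> D \<Longrightarrow> h (F i a b) = F i (h a) (h b)"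
  obtains g where "g \<in> Aut R F" "\<And>a. a \<in> D \<Longrightarrow> g a = h a"
proof -
  have "closed_under F (h ` D)"
    unfolding closed_under_def using hF closed_underD[OF D(2)] by (auto simp flip: hF)
  then have e: "gen F D = D" "gen F (h ` D) = h ` D" using D(2) by (simp_all add: gen_of_closed_under)
  have uh: "ultrahomogeneous R F" using BKL by (simp add: is_BKL2_def)
  have "finite D \<and> finite (h ` D) \<and> bij_betw h (gen F D) (gen F (h ` D)) \<and>
      (\<forall>j. \<forall>a\<in>gen F D. \<forall>b\<in>gen F D. R j a b \<longleftrightarrow> R j (h a) (h b)) \<and>
      (\<forall>i. \<forall>a\<in>gen F D. \<forall>b\<in>gen F D. h (F i a b) = F i (h a) (h b))"
    unfolding e using D(1) h hR hF by (simp add: inj_on_imp_bij_betw)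
  from uh[unfolded ultrahomogeneous_def, rule_format, OF this]
  have "\<exists>g\<in>Aut R F. \<forall>a\<in>gen F D. g a = h a" .
  then show ?thesis using that e(1) by blast
qed

text \<open>Universality embeds the amalgam of two copies of \<open>D\<close> over \<open>A\<close>,
  and ultrahomogeneity makes each embedded copy the image of \<open>D\<close> under an automorphism.
  Comparing these two automorphisms gives \<open>g\<close>.\<close>

lemma amalgamation:
  assumes D: "finite D" "closed_under F D" and A: "A \<subseteq> D" "closed_under F A"
  obtains g where "g \<in> Aut R F" "\<And>a. a \<in> A \<Longrightarrow> g a = a" "g ` D \<inter> D \<subseteq> A"
proof -
  obtain K :: "nat set" and R' F' and p q :: "nat \<Rightarrow> nat" where
    K: "finite K" "L2_axioms K R' F'" and
    pq: "p ` D \<subseteq> K" "q ` D \<subseteq> K" "inj_on p D" "inj_on q D" "p ` D \<inter> q ` D \<subseteq> p ` A"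
    "\<And>a. a \<in> A \<Longrightarrow> p a = q a" and
    R': "\<And>j a b. a \<in> D \<Longrightarrow> b \<in> D \<Longrightarrow> R' j (p a) (p b) = R j a b"
    "\<And>j a b. a \<in> D \<Longrightarrow> b \<in> D \<Longrightarrow> R' j (q a) (q b) = R j a b" and
    F': "\<And>i a b. a \<in> D \<Longrightarrow> b \<in> D \<Longrightarrow> F' i (p a) (p b) = p (F i a b)"
    "\<And>i a b. a \<in> D \<Longrightarrow> b \<in> D \<Longrightarrow> F' i (q a) (q b) = q (F i a b)"
    using amalgam_exists[OF L2 D A] by blast
  have fu: "finite_universal R F" using BKL by (simp add: is_BKL2_def)
  from fu[unfolded finite_universal_def, rule_format, OF conjI[OF K]]
  obtain e where e: "inj_on e K" "\<And>j a b. a \<in> K \<Longrightarrow> b \<in> K \<Longrightarrow> R' j a b = R j (e a) (e b)"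
    "\<And>i a b. a \<in> K \<Longrightarrow> b \<in> K \<Longrightarrow> e (F' i a b) = F i (e a) (e b)"
    by blast
  have copy: "\<exists>g\<in>Aut R F. \<forall>a\<in>D. g a = e (r a)"
    if r: "inj_on r D" "r ` D \<subseteq> K" "\<And>j a b. a \<in> D \<Longrightarrow> b \<in> D \<Longrightarrow> R' j (r a) (r b) = R j a b"
      "\<And>i a b. a \<in> D \<Longrightarrow> b \<in> D \<Longrightarrow> F' i (r a) (r b) = r (F i a b)" for r
  proof -
    have rK: "r a \<in> K" if "a \<in> D" for a using r(2) that by blast
    obtain g where "g \<in> Aut R F" "\<And>a. a \<in> D \<Longrightarrow> g a = (e \<circ> r) a"
    proof (rule extend_partial_automorphism[OF D, of "e \<circ> r"])
      show "inj_on (e \<circ> r) D" by (rule comp_inj_on[OF r(1) inj_on_subset[OF e(1) r(2)]])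
      show "R j ((e \<circ> r) a) ((e \<circ> r) b) = R j a b" if "a \<in> D" "b \<in> D" for j a b
        using that e(2)[OF rK rK] r(3) by simp
      show "(e \<circ> r) (F i a b) = F i ((e \<circ> r) a) ((e \<circ> r) b)" if "a \<in> D" "b \<in> D" for i a b
        using that e(3)[OF rK rK] r(4) by simp
    qed blast
    then show ?thesis by auto
  qed
  obtain g1 where g1: "g1 \<in> Aut R F" "\<And>a. a \<in> D \<Longrightarrow> g1 a = e (p a)"
    using copy[OF pq(3,1) R'(1) F'(1)] by blast
  obtain g2 where g2: "g2 \<in> Aut R F" "\<And>a. a \<in> D \<Longrightarrow> g2 a = e (q a)"
    using copy[OF pq(4,2) R'(2) F'(2)] by blast
  have b1: "bij g1" using g1(1) by (simp add: Aut_def)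
  show ?thesis
  proof
    show "inv g1 \<circ> g2 \<in> Aut R F" using g1(1) g2(1) by (intro Aut_comp Aut_inv)
    show "(inv g1 \<circ> g2) a = a" if "a \<in> A" for a
    proof -
      have "g2 a = g1 a" using that A(1) g1(2) g2(2) pq(6) by auto
      then show ?thesis using b1 by (simp add: bij_is_inj)
    qed
    show "(inv g1 \<circ> g2) ` D \<inter> D \<subseteq> A"
    proof
      fix u assume u: "u \<in> (inv g1 \<circ> g2) ` D \<inter> D"
      then obtain d where d: "d \<in> D" "u = inv g1 (g2 d)" by auto
      then have "g1 u = g2 d" using b1 by (simp add: bij_is_surj surj_f_inv_f)
      then have "e (p u) = e (q d)" using u d g1(2) g2(2) by simp
      moreover have "p u \<in> K" "q d \<in> K" using pq(1,2) u d(1) by auto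
      ultimately have "p u = q d" using e(1) by (meson inj_onD)
      then have "p u \<in> p ` A" using pq(5) u d(1) by blast
      then show "u \<in> A" using pq(3) u A(1) by (auto dest: inj_onD)
    qed
  qed
qed

end

section \<open>Open sets in products\<close>

lemma open_fun_contains_box:
  fixes u :: "'i \<Rightarrow> 'a::topological_space"
  assumes "open U" "u \<in> U"
  obtains X where "\<And>i. open (X i)" "finite {i. X i \<noteq> UNIV}" "\<And>i. u i \<in> X i"
    "\<And>y. (\<And>i. y i \<in> X i) \<Longrightarrow> y \<in> U"
proof -
  have "openin (product_topology (\<lambda>i. euclidean) UNIV) U" using assms(1) by (simp add: open_fun_def)
  from product_topology_open_contains_basis[OF this assms(2)]
  obtain X where X: "u \<in> (\<Pi>\<^sub>E i\<in>UNIV. X i)" "\<forall>i. openin euclidean (X i)"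
      "finite {i. X i \<noteq> topspace euclidean}" "(\<Pi>\<^sub>E i\<in>UNIV. X i) \<subseteq> U"
    by blast
  show ?thesis
  proof
    show "open (X i)" for i using X(2) by simp
    show "finite {i. X i \<noteq> UNIV}" using X(3) by simp
    show "u i \<in> X i" for i using X(1) by (simp add: PiE_iff)
    show "y \<in> U" if "\<And>i. y i \<in> X i" for y using X(4) that by (auto simp: PiE_iff)
  qed
qed

lemma open_fun_finite_support:
  fixes u :: "'i \<Rightarrow> 'a::topological_space"
  assumes "open U" "u \<in> U"
  obtains E where "finite E" "\<And>y. (\<And>i. i \<in> E \<Longrightarrow> y i = u i) \<Longrightarrow> y \<in> U"
proof -
  obtain X where X: "finite {i. X i \<noteq> UNIV}" "\<And>i. u i \<in> X i"
    "\<And>y. (\<And>i. y i \<in> X i) \<Longrightarrow> y \<in> U"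
    using open_fun_contains_box[OF assms] by metis
  show ?thesis
  proof
    show "finite {i. X i \<noteq> UNIV}" by (rule X(1))
    show "y \<in> U" if y: "\<And>i. i \<in> {i. X i \<noteq> UNIV} \<Longrightarrow> y i = u i" for y
    proof (rule X(3))
      show "y i \<in> X i" for i using y[of i] X(2)[of i] by (cases "X i = UNIV") auto
    qed
  qed
qed

text \<open>Boxes impose their conditions coordinate by coordinate, so mixing two points of a box
  along any set of coordinates stays inside it.\<close>

lemma open_fun_mixable_subset:
  fixes u :: "'i \<Rightarrow> 'a::topological_space"
  assumes "open U" "u \<in> U"
  obtains V where "open V" "u \<in> V" "V \<subseteq> U"
    "\<And>S v w. v \<in> V \<Longrightarrow> w \<in> V \<Longrightarrow> (\<lambda>i. if i \<in> S then v i else w i) \<in> V"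
proof -
  obtain X where X: "\<And>i. open (X i)" "finite {i. X i \<noteq> UNIV}" "\<And>i. u i \<in> X i"
    "\<And>y. (\<And>i. y i \<in> X i) \<Longrightarrow> y \<in> U"
    using open_fun_contains_box[OF assms] by metis
  show ?thesis
  proof
    show "open (Pi\<^sub>E UNIV X)" by (rule open_PiE[OF X(1,2)])
    show "u \<in> Pi\<^sub>E UNIV X" using X(3) by (simp add: PiE_iff)
    show "Pi\<^sub>E UNIV X \<subseteq> U" using X(4) by (auto simp: PiE_iff)
  qed (auto simp: PiE_iff)
qed

lemma continuous_on_comp_right:
  fixes h :: "'j \<Rightarrow> 'i"
  shows "continuous_on S (\<lambda>x :: 'i \<Rightarrow> 'a::topological_space. x \<circ> h)"
  unfolding comp_def
  by (intro continuous_on_coordinatewise_then_product continuous_on_subset[OF continuous_on_product_coordinates]) simp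

lemma open_comp_right:
  assumes "open (U :: ('j \<Rightarrow> 'a::topological_space) set)"
  shows "open {x. x \<circ> h \<in> U}"
  using open_vimage[OF assms continuous_on_comp_right[of UNIV h]] by (simp add: vimage_def)

text \<open>This is the cylinder over the projection of \<open>U\<close> to the coordinates in
  \<open>A\<close>.\<close>

definition saturation :: "'i set \<Rightarrow> ('i \<Rightarrow> 'a) set \<Rightarrow> ('i \<Rightarrow> 'a) set" where
  "saturation A U = {z. \<exists>y\<in>U. \<forall>a\<in>A. y a = z a}"

lemma saturation_superset: "U \<subseteq> saturation A U"
  by (auto simp: saturation_def)

lemma saturation_cong: "y \<in> saturation A U \<Longrightarrow> (\<And>a. a \<in> A \<Longrightarrow> z a = y a) \<Longrightarrow> z \<in> saturation A U"
  by (auto simp: saturation_def)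

text \<open>Overwriting the coordinates in \<open>A\<close> of a fixed witness \<open>y\<close> is
  continuous, and the preimage of \<open>U\<close> under this operation is the required
  neighbourhood.\<close>

lemma open_saturation:
  fixes U :: "('i \<Rightarrow> 'a::topological_space) set"
  assumes "open U"
  shows "open (saturation A U)"
  unfolding open_subopen[of "saturation A U"]
proof
  fix z assume "z \<in> saturation A U"
  then obtain y where y: "y \<in> U" "\<forall>a\<in>A. y a = z a" by (auto simp: saturation_def)
  define m where "m z' i = (if i \<in> A then z' i else y i)" for z' :: "'i \<Rightarrow> 'a" and i
  have "continuous_on UNIV m"
  proof (rule continuous_on_coordinatewise_then_product)
    show "continuous_on UNIV (\<lambda>z'. m z' i)" for i
      unfolding m_def by (cases "i \<in> A") simp_all
  qed
  then have "open (m -` U)" by (rule open_vimage[OF assms])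
  moreover have "m z = y" using y(2) by (auto simp: m_def fun_eq_iff)
  then have "z \<in> m -` U" using y(1) by simp
  moreover have "m -` U \<subseteq> saturation A U"
    unfolding saturation_def by (auto simp: m_def intro!: bexI[of _ "m _"])
  ultimately show "\<exists>T. open T \<and> z \<in> T \<and> T \<subseteq> saturation A U" by blast
qed

lemma closedin_equalizer:
  fixes u v :: "'a::topological_space \<Rightarrow> real"
  assumes "continuous_on S u" "continuous_on S v"
  shows "closedin (top_of_set S) {x \<in> S. u x = v x}"
proof -
  have "closedin (top_of_set S) {x \<in> S. u x - v x = 0}"
    by (rule continuous_closedin_preimage_constant) (intro continuous_on_diff assms)
  then show ?thesis by simp
qed

section \<open>Invariant clique-valued maps\<close>

text \<open>The sets \<open>V n\<close> are kept visible because a limit of elements of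
  \<open>Q\<close> need not belong to \<open>Q\<close>, so invariance of \<open>C\<close> does not
  place it in \<open>C\<close>. Continuity is asked of the composites of \<open>t m\<close> with
  entries of \<open>f\<close>, since a Borel function need not be continuous on the values that
  \<open>f\<close> takes.\<close>

locale generic_clique_map = BKL_structure +
  fixes t :: "nat \<Rightarrow> real \<Rightarrow> real" and f :: "(nat \<Rightarrow> real) \<Rightarrow> nat \<Rightarrow> real"
    and Q :: "(nat \<Rightarrow> nat) set" and V :: "nat \<Rightarrow> (nat \<Rightarrow> real) set" and C :: "(nat \<Rightarrow> real) set"
  assumes countable_Q: "countable Q" and Q_Aut: "Q \<subseteq> Aut R F" and Q_id: "id \<in> Q"
    and Q_comp: "g \<in> Q \<Longrightarrow> h \<in> Q \<Longrightarrow> g \<circ> h \<in> Q" and Q_inv: "g \<in> Q \<Longrightarrow> inv g \<in> Q"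
    and Q_dense: "g \<in> Aut R F \<Longrightarrow> finite E \<Longrightarrow> \<exists>h\<in>Q. \<forall>a\<in>E. h a = g a"
    and V_open: "open (V n)" and C_eq: "C = (\<Inter>n. V n)" and C_comeager: "comeager C"
    and C_inv: "x \<in> C \<Longrightarrow> h \<in> Q \<Longrightarrow> x \<circ> h \<in> C"
    and f_cont: "continuous_on C (\<lambda>x. f x n)"
    and tf_cont: "continuous_on C (\<lambda>x. t m (f x n))"
    and f_inv: "g \<in> Aut R F \<Longrightarrow> range (f (x \<circ> g)) = range (f x)"
    and f_clique: "is_clique (fgraph t) (range (f x))"
begin

lemma Q_bij: "h \<in> Q \<Longrightarrow> bij h"
  using Q_Aut Aut_bij by blast

lemma comp_inv_right: "h \<in> Q \<Longrightarrow> x \<circ> h \<circ> inv h = x"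
  using surj_iff[THEN iffD1, OF bij_is_surj[OF Q_bij]] by (simp only: comp_assoc comp_id)

lemma comp_inv_left: "h \<in> Q \<Longrightarrow> x \<circ> inv h \<circ> h = x"
  using Q_bij[of h] by (simp only: comp_assoc bij_is_inj inv_o_cancel comp_id)

lemma open_meets_C: "open U \<Longrightarrow> U \<noteq> {} \<Longrightarrow> \<exists>x\<in>U. x \<in> C"
  using comeager_meets_open[OF C_comeager] by blast

section \<open>Stabilizers and finite supports of entries\<close>

definition stab :: "nat set \<Rightarrow> (nat \<Rightarrow> nat) set" where
  "stab A = {h \<in> Q. \<forall>a\<in>A. h a = a}"

lemma stab_Q: "h \<in> stab A \<Longrightarrow> h \<in> Q"
  by (simp add: stab_def)

lemma stab_id: "id \<in> stab A"
  by (simp add: stab_def Q_id)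

lemma stab_comp: "g \<in> stab A \<Longrightarrow> h \<in> stab A \<Longrightarrow> g \<circ> h \<in> stab A"
  by (simp add: stab_def Q_comp)

lemma stab_inv: "h \<in> stab A \<Longrightarrow> inv h \<in> stab A"
  by (simp add: stab_def Q_inv inv_f_eq bij_is_inj[OF Q_bij])

text \<open>If no finite condition decided the coordinate, a back-and-forth limit of elements of \<open>Q\<close>
  would give an automorphism \<open>g\<close> with \<open>x \<circ> g\<close> in \<open>C\<close> and \<open>b\<close> omitted from its image.\<close>

lemma omitting_automorphism:
  assumes x: "x \<in> C"
    and avoid: "\<And>h0 A k. h0 \<in> Q \<Longrightarrow> finite A \<Longrightarrow> \<exists>h\<in>Q. (\<forall>a\<in>A. h a = h0 a) \<and> f (x \<circ> h) k \<noteq> b"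
  obtains g where "g \<in> Aut R F" "b \<notin> range (f (x \<circ> g))"
proof -
  define P where "P s \<longleftrightarrow> fst s \<in> Q \<and> finite (snd s)" for s :: "(nat \<Rightarrow> nat) \<times> nat set"
  \<comment> \<open>A state is an element of \<open>Q\<close> with a finite set on which it is
    frozen. Step \<open>n\<close> freezes \<open>n\<close> and its preimage, which makes the limit
    total and onto, and secures both \<open>V n\<close> and the omission of \<open>b\<close> at
    index \<open>n\<close>. The omission is conditional on \<open>y \<in> C\<close>, where
    \<open>f\<close> is continuous; the condition is discharged once every \<open>V n\<close> is
    secured.\<close>
  define S where "S n s s' \<longleftrightarrow> (\<forall>a\<in>snd s. fst s' a = fst s a) \<and> snd s \<subseteq> snd s' \<and> n \<in> snd s' \<and>
      inv (fst s') n \<in> snd s' \<and>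
      (\<forall>y. (\<forall>a\<in>snd s'. y a = x (fst s' a)) \<longrightarrow> y \<in> V n \<and> (y \<in> C \<longrightarrow> f y n \<noteq> b))"
    for n and s s' :: "(nat \<Rightarrow> nat) \<times> nat set"
  have step: "\<exists>s'. P s' \<and> S n s s'" if "P s" for n s
  proof -
    obtain h where h: "h \<in> Q" "\<forall>a\<in>snd s. h a = fst s a" "f (x \<circ> h) n \<noteq> b"
      using avoid[of "fst s" "snd s" n] \<open>P s\<close> unfolding P_def by blast
    have xh: "x \<circ> h \<in> C" using x h(1) by (rule C_inv)
    have "\<exists>U. open U \<and> U \<inter> C = (\<lambda>y. f y n) -` (- {b}) \<inter> C"
      using f_cont[of n] unfolding continuous_on_open_invariant by blast
    then obtain U where U: "open U" "U \<inter> C = (\<lambda>y. f y n) -` (- {b}) \<inter> C" by blast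
    have "x \<circ> h \<in> U \<inter> V n" using U(2) xh h(3) C_eq by auto
    then obtain E where E: "finite E" "\<And>y. (\<And>i. i \<in> E \<Longrightarrow> y i = (x \<circ> h) i) \<Longrightarrow> y \<in> U \<inter> V n"
      using open_fun_finite_support[OF open_Int[OF U(1) V_open[of n]]] by blast
    define A' where "A' = snd s \<union> {n, inv h n} \<union> E"
    have "y \<in> V n \<and> (y \<in> C \<longrightarrow> f y n \<noteq> b)" if "\<forall>a\<in>A'. y a = x (h a)" for y
    proof -
      have "y \<in> U \<inter> V n" by (rule E(2)) (use that in \<open>simp add: A'_def\<close>)
      then show ?thesis using U(2) by blast
    qed
    moreover have "snd s \<subseteq> A'" "n \<in> A'" "inv h n \<in> A'" by (auto simp: A'_def)
    ultimately have "S n s (h, A')" using h(2) by (simp add: S_def)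
    moreover have "P (h, A')" using h(1) E(1) \<open>P s\<close> by (simp add: P_def A'_def)
    ultimately show ?thesis by blast
  qed
  have start: "P (id, {})" using Q_id by (simp add: P_def)
  have "\<exists>s. \<forall>n. P (s n) \<and> S n (s n) (s (Suc n))"
    by (rule dependent_nat_choice) (use start step in blast)+
  then obtain s where s: "\<And>n. P (s n)" "\<And>n. S n (s n) (s (Suc n))" by blast
  define h where "h n = fst (s n)" for n
  define A where "A n = snd (s n)" for n
  have hQ: "h n \<in> Q" for n using s(1) by (simp add: P_def h_def)
  have step1: "\<forall>a\<in>A n. h (Suc n) a = h n a" "A n \<subseteq> A (Suc n)" "n \<in> A (Suc n)" "inv (h (Suc n)) n \<in> A (Suc n)"
    and step2: "\<And>y. (\<forall>a\<in>A (Suc n). y a = x (h (Suc n) a)) \<Longrightarrow> y \<in> V n \<and> (y \<in> C \<longrightarrow> f y n \<noteq> b)" for n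
    using s(2)[of n] unfolding S_def h_def A_def by blast+
  have A_mono: "A m \<subseteq> A n" if "m \<le> n" for m n
    using that step1(2) by (rule lift_Suc_mono_le[rotated])
  have coh: "h n a = h m a" if "m \<le> n" "a \<in> A m" for m n a
    using that(1)
  proof (induction n rule: dec_induct)
    case base
    then show ?case ..
  next
    case (step n)
    then have "a \<in> A n" using A_mono that(2) by blast
    then show ?case using step step1(1) by simp
  qed
  \<comment> \<open>Step \<open>a\<close> puts \<open>a\<close> into \<open>A (Suc a)\<close>, so
    the value at \<open>a\<close> is frozen from stage \<open>Suc a\<close> on.\<close>
  define g where "g a = h (Suc a) a" for a
  have g_eq: "g a = h n a" if "a \<in> A n" for n a
  proof (cases "n \<le> Suc a")
    case True
    then show ?thesis using coh[OF True that] by (simp add: g_def)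
  next
    case False
    then show ?thesis using coh[of "Suc a" n a] step1(3)[of a] by (simp add: g_def)
  qed
  have inA: "a \<in> A n" if "a < n" for a n
    using step1(3)[of a] A_mono[of "Suc a" n] that by auto
  have g_fin: "\<exists>n. \<forall>a\<in>E. g a = h n a" if E: "finite E" for E
  proof -
    obtain n where "\<forall>a\<in>E. a < n" using finite_nat_set_iff_bounded E by blast
    then show ?thesis using inA g_eq by blast
  qed
  have "inj g"
  proof (rule injI)
    fix a a' assume e: "g a = g a'"
    obtain n where "\<forall>c\<in>{a, a'}. g c = h n c" using g_fin[of "{a, a'}"] by auto
    then have "h n a = h n a'" using e by simp
    then show "a = a'" using Q_bij[OF hQ[of n]] by (meson bij_is_inj injD)
  qed
  moreover have "surj g"
  proof (rule surjI)
    show "g (inv (h (Suc n)) n) = n" for n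
      using g_eq[OF step1(4)] Q_bij[OF hQ[of "Suc n"]] by (simp add: bij_is_surj surj_f_inv_f)
  qed
  moreover have "R j a c \<longleftrightarrow> R j (g a) (g c)" for j a c
  proof -
    obtain n where "\<forall>d\<in>{a, c}. g d = h n d" using g_fin[of "{a, c}"] by auto
    then show ?thesis using Q_Aut hQ[of n] by (auto simp: Aut_def)
  qed
  moreover have "g (F i a c) = F i (g a) (g c)" for i a c
  proof -
    obtain n where "\<forall>d\<in>{a, c, F i a c}. g d = h n d" using g_fin[of "{a, c, F i a c}"] by auto
    then show ?thesis using Q_Aut hQ[of n] by (auto simp: Aut_def)
  qed
  ultimately have gA: "g \<in> Aut R F" unfolding Aut_def bij_def by blast
  have y: "x \<circ> g \<in> V n \<and> (x \<circ> g \<in> C \<longrightarrow> f (x \<circ> g) n \<noteq> b)" for n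
    by (rule step2) (simp add: g_eq)
  then have "x \<circ> g \<in> C" unfolding C_eq by blast
  then have "b \<notin> range (f (x \<circ> g))" using y by (metis rangeE)
  then show ?thesis using that gA by blast
qed

text \<open>By invariance \<open>f x n\<close> stays in the range of \<open>f (x \<circ> g)\<close>
  for every automorphism \<open>g\<close>, so it cannot be omitted. Hence some finite piece of an
  element of \<open>Q\<close> forces it to appear, at an index \<open>k\<close> that may differ from
  \<open>n\<close>.\<close>

lemma pointwise_support:
  assumes "x \<in> C"
  shows "\<exists>h0\<in>Q. \<exists>A k. finite A \<and> (\<forall>h\<in>Q. (\<forall>a\<in>A. h a = h0 a) \<longrightarrow> f (x \<circ> h) k = f x n)"
proof (rule ccontr)
  assume "\<not> ?thesis"
  then have avoid: "\<exists>h\<in>Q. (\<forall>a\<in>A. h a = h0 a) \<and> f (x \<circ> h) k \<noteq> f x n" if "h0 \<in> Q" "finite A" for h0 A k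
    using that by meson
  obtain g where "g \<in> Aut R F" "f x n \<notin> range (f (x \<circ> g))"
    using omitting_automorphism[OF assms avoid] by blast
  then show False using f_inv[of g x] by blast
qed

text \<open>The support found at one point depends on that point, but there are only countably many
  triples \<open>(h0, A, k)\<close> and each works on a relatively closed set, so one of them works
  on an open set. Enlarging \<open>A\<close> to a finite closed set only reduces the
  \<open>h\<close> to be tested.\<close>

lemma locally_uniform_support:
  assumes W: "open W" "W \<noteq> {}"
  obtains W' h0 A k where "open W'" "W' \<noteq> {}" "W' \<subseteq> W" "h0 \<in> Q" "finite A" "closed_under F A"
    "\<And>x h. x \<in> W' \<Longrightarrow> x \<in> C \<Longrightarrow> h \<in> stab A \<Longrightarrow> f (x \<circ> h0 \<circ> h) k = f x n"
proof -
  define I where "I = Q \<times> {A :: nat set. finite A} \<times> (UNIV :: nat set)"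
  define H where "H h0 A = {h \<in> Q. \<forall>a\<in>A. h a = h0 a}" for h0 :: "nat \<Rightarrow> nat" and A
  define T where "T i = (case i of (h0, A, k) \<Rightarrow> \<Inter>h\<in>H h0 A. {x \<in> C. f (x \<circ> h) k = f x n})" for i
  have "countable I"
    unfolding I_def using countable_Q countable_Collect_finite by (intro countable_SIGMA) auto
  moreover have "closedin (top_of_set C) (T i)" if "i \<in> I" for i
  proof -
    obtain h0 A k where i: "i = (h0, A, k)" by (cases i)
    then have "h0 \<in> H h0 A" using \<open>i \<in> I\<close> by (simp add: I_def H_def)
    moreover have "closedin (top_of_set C) {x \<in> C. f (x \<circ> h) k = f x n}" if "h \<in> H h0 A" for h
    proof (rule closedin_equalizer[OF _ f_cont])
      have "h \<in> Q" using that by (simp add: H_def)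
      then have "(\<lambda>x. x \<circ> h) ` C \<subseteq> C" using C_inv by blast
      then show "continuous_on C (\<lambda>x. f (x \<circ> h) k)"
        by (rule continuous_on_compose2[OF f_cont continuous_on_comp_right])
    qed
    ultimately show ?thesis unfolding T_def i by (auto intro!: closedin_Inter)
  qed
  moreover have "W \<inter> C \<subseteq> (\<Union>i\<in>I. T i)"
  proof
    fix x assume x: "x \<in> W \<inter> C"
    then obtain h0 A k where "h0 \<in> Q" "finite A"
      "\<forall>h\<in>Q. (\<forall>a\<in>A. h a = h0 a) \<longrightarrow> f (x \<circ> h) k = f x n"
      using pointwise_support[of x n] by blast
    then show "x \<in> (\<Union>i\<in>I. T i)"
      using x by (intro UN_I[of "(h0, A, k)"]) (auto simp: I_def T_def H_def)
  qed
  ultimately obtain i W' where iW: "i \<in> I" "open W'" "W' \<noteq> {}" "W' \<subseteq> W" "W' \<inter> C \<subseteq> T i"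
    using comeager_closed_cover[OF C_comeager W, of I T] by blast
  obtain h0 A k where i: "i = (h0, A, k)" by (cases i)
  have h0: "h0 \<in> Q" "finite A" using iW(1) by (simp_all add: i I_def)
  obtain D where D: "finite D" "closed_under F D" "A \<subseteq> D" using finite_closed_superset[OF h0(2)] by blast
  show ?thesis
  proof (rule that[OF iW(2-4) h0(1) D(1,2)])
    fix x h assume x: "x \<in> W'" "x \<in> C" and h: "h \<in> stab D"
    have "h0 \<circ> h \<in> H h0 A" using h h0(1) D(3) Q_comp by (auto simp: stab_def H_def)
    moreover have "x \<in> T i" using x iW(5) by blast
    ultimately have "f (x \<circ> (h0 \<circ> h)) k = f x n" unfolding T_def i by blast
    then show "f (x \<circ> h0 \<circ> h) k = f x n" by (simp only: comp_assoc)
  qed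
qed

text \<open>An automorphism fixing \<open>A\<close> can carry a finite closed set \<open>D\<close>
  off itself outside \<open>A\<close>. So \<open>y\<close> is kept on \<open>D\<close> while the
  values of \<open>u\<close> are stored on the image of \<open>D\<close>. The set \<open>E\<close>
  protects coordinates whose values a later move still needs.\<close>

lemma stab_moves_into_open:
  assumes A: "finite A" "closed_under F A" and U: "open U" "u \<in> U" and W: "open W" "y \<in> W"
    and agree: "\<And>a. a \<in> A \<Longrightarrow> y a = u a" and E: "finite E"
  obtains h z where "h \<in> stab A" "z \<in> W" "\<And>a. a \<in> E \<Longrightarrow> z a = y a" "z \<circ> h \<in> U"
proof -
  obtain E1 where E1: "finite E1" "\<And>v. (\<And>i. i \<in> E1 \<Longrightarrow> v i = u i) \<Longrightarrow> v \<in> U"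
    using open_fun_finite_support[OF U] by blast
  obtain E2 where E2: "finite E2" "\<And>v. (\<And>i. i \<in> E2 \<Longrightarrow> v i = y i) \<Longrightarrow> v \<in> W"
    using open_fun_finite_support[OF W] by blast
  have "finite (A \<union> E \<union> E1 \<union> E2)" using A(1) E E1(1) E2(1) by simp
  from finite_closed_superset[OF this]
  obtain D where D: "finite D" "closed_under F D" "A \<union> E \<union> E1 \<union> E2 \<subseteq> D" by blast
  have AD: "A \<subseteq> D" using D(3) by blast
  obtain g where g: "g \<in> Aut R F" "\<And>a. a \<in> A \<Longrightarrow> g a = a" "g ` D \<inter> D \<subseteq> A"
    using amalgamation[OF D(1,2) AD A(2)] by blast
  obtain h where h: "h \<in> Q" "\<forall>a\<in>D. h a = g a" using Q_dense[OF g(1) D(1)] by blast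
  define z where "z d = (if d \<in> D then y d else u (inv h d))" for d
  have bh: "inj h" using Q_bij[OF h(1)] by (rule bij_is_inj)
  have zh: "z (h d) = u d" if d: "d \<in> D" for d
  proof (cases "d \<in> A")
    case True
    then show ?thesis using h(2) d g(2) agree by (simp add: z_def)
  next
    case False
    \<comment> \<open>A point of \<open>D\<close> that lands in \<open>D\<close> lands in
      \<open>A\<close>, which is fixed pointwise; injectivity then puts the point itself in
      \<open>A\<close>.\<close>
    have "h d \<notin> D"
    proof
      assume "h d \<in> D"
      then have "h d \<in> A" using g(3) h(2) d by auto
      then have "h (h d) = h d" using h(2) AD g(2) by auto
      then have "h d = d" using bh by (simp add: inj_eq)
      then show False using \<open>h d \<in> A\<close> False by simp
    qed
    then show ?thesis using bh by (simp add: z_def)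
  qed
  show ?thesis
  proof
    show "h \<in> stab A" using h g(2) AD by (auto simp: stab_def)
    show "z \<in> W" by (rule E2(2)) (use D(3) in \<open>auto simp: z_def\<close>)
    show "z a = y a" if "a \<in> E" for a using that D(3) by (auto simp: z_def)
    show "z \<circ> h \<in> U" by (rule E1(2)) (use D(3) zh in auto)
  qed
qed

text \<open>A failure at \<open>z\<close> persists at all points of \<open>C\<close> near
  \<open>z\<close>. Some generic \<open>v\<close> there has a translate \<open>v \<circ> h'\<close>
  in \<open>U\<close> with \<open>h'\<close> in \<open>stab A\<close>, and \<open>\<phi>\<close> is
  constant on the \<open>stab A\<close>-orbit of this translate, which contains both
  \<open>v\<close> and \<open>v \<circ> h\<close>.\<close>

lemma stab_invariance_saturation:
  assumes A: "finite A" "closed_under F A" and U: "open U" and \<phi>: "continuous_on C \<phi>"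
    and inv: "\<And>y h. y \<in> U \<Longrightarrow> y \<in> C \<Longrightarrow> h \<in> stab A \<Longrightarrow> \<phi> (y \<circ> h) = \<phi> y"
    and z: "z \<in> saturation A U" "z \<in> C" and h: "h \<in> stab A"
  shows "\<phi> (z \<circ> h) = (\<phi> z :: real)"
proof (rule ccontr)
  assume ne: "\<phi> (z \<circ> h) \<noteq> \<phi> z"
  have "(\<lambda>x. x \<circ> h) ` C \<subseteq> C" using C_inv stab_Q[OF h] by blast
  then have c: "continuous_on C (\<lambda>x. \<phi> (x \<circ> h))"
    by (rule continuous_on_compose2[OF \<phi> continuous_on_comp_right])
  have "continuous_on C (\<lambda>x. \<phi> (x \<circ> h) - \<phi> x)" by (intro continuous_on_diff c \<phi>)
  then have "\<exists>N. open N \<and> N \<inter> C = (\<lambda>x. \<phi> (x \<circ> h) - \<phi> x) -` (- {0}) \<inter> C"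
    unfolding continuous_on_open_invariant by blast
  then obtain N where N: "open N" "N \<inter> C = (\<lambda>x. \<phi> (x \<circ> h) - \<phi> x) -` (- {0}) \<inter> C" by blast
  have zN: "z \<in> N" using N(2) z(2) ne by auto
  obtain y where y: "y \<in> U" "\<forall>a\<in>A. y a = z a" using z(1) by (auto simp: saturation_def)
  obtain h' w where h': "h' \<in> stab A" and w: "w \<in> N" "w \<circ> h' \<in> U"
    using stab_moves_into_open[OF A U y(1) N(1) zN, of "{}"] y(2) by auto
  have "open (N \<inter> {x. x \<circ> h' \<in> U})" by (intro open_Int N(1) open_comp_right U)
  then obtain v where v: "v \<in> N" "v \<circ> h' \<in> U" "v \<in> C" using open_meets_C w by blast
  have vC: "v \<circ> h' \<in> C" using v(3) stab_Q[OF h'] by (rule C_inv)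
  have "\<phi> (v \<circ> h' \<circ> k) = \<phi> (v \<circ> h')" if "k \<in> stab A" for k using inv[OF v(2) vC that] .
  from this[OF stab_inv[OF h']] this[OF stab_comp[OF stab_inv[OF h'] h]]
  have "\<phi> (v \<circ> h) = \<phi> v"
    unfolding comp_assoc[symmetric] comp_inv_right[OF stab_Q[OF h']] by simp
  then show False using N(2) v(1,3) by auto
qed

text \<open>The values of a generic point on disjoint substructures \<open>A\<close> and \<open>B\<close> are independent.\<close>

lemma independent_equal_imp_constant:
  assumes A: "finite A" "closed_under F A" and B: "finite B" "closed_under F B" and AB: "A \<inter> B = {}"
    and W: "open W" "W \<noteq> {}" and \<alpha>: "continuous_on C \<alpha>" and \<beta>: "continuous_on C \<beta>"
    and eq: "\<And>y. y \<in> W \<Longrightarrow> y \<in> C \<Longrightarrow> \<alpha> y = (\<beta> y :: real)"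
    and invA: "\<And>y h. y \<in> W \<Longrightarrow> y \<in> C \<Longrightarrow> h \<in> stab A \<Longrightarrow> \<alpha> (y \<circ> h) = \<alpha> y"
    and invB: "\<And>y h. y \<in> W \<Longrightarrow> y \<in> C \<Longrightarrow> h \<in> stab B \<Longrightarrow> \<beta> (y \<circ> h) = \<beta> y"
  obtains W' c where "open W'" "W' \<noteq> {}" "W' \<subseteq> W" "\<And>y. y \<in> W' \<Longrightarrow> y \<in> C \<Longrightarrow> \<alpha> y = c"
proof -
  obtain w where "w \<in> W" using W(2) by blast
  then obtain W' where W': "open W'" "w \<in> W'" "W' \<subseteq> W"
    and mix: "\<And>S v w. v \<in> W' \<Longrightarrow> w \<in> W' \<Longrightarrow> (\<lambda>i. if i \<in> S then v i else w i) \<in> W'"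
    using open_fun_mixable_subset[OF W(1)] by metis
  have "\<alpha> y = \<alpha> y'" if y: "y \<in> W'" "y \<in> C" and y': "y' \<in> W'" "y' \<in> C" for y y'
  proof (rule ccontr)
    assume ne: "\<alpha> y \<noteq> \<alpha> y'"
    obtain M M' where M: "open M" "open M'" "\<alpha> y \<in> M" "\<alpha> y' \<in> M'" "M \<inter> M' = {}"
      using hausdorff[OF ne] by blast
    obtain N where N: "open N" "N \<inter> C = \<alpha> -` M \<inter> C"
      using \<alpha> M(1) unfolding continuous_on_open_invariant by blast
    obtain N' where N': "open N'" "N' \<inter> C = \<alpha> -` M' \<inter> C"
      using \<alpha> M(2) unfolding continuous_on_open_invariant by blast
    have U: "open (N \<inter> W')" "y \<in> N \<inter> W'" using N W'(1) y M(3) by auto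
    have U': "open (N' \<inter> W')" "y' \<in> N' \<inter> W'" using N' W'(1) y' M(4) by auto
    \<comment> \<open>The point \<open>z0\<close> imitates \<open>y\<close> on \<open>A\<close> and
      \<open>y'\<close> on \<open>B\<close>; the choice of \<open>W'\<close> guarantees that this
      mixture stays in \<open>W'\<close>.\<close>
    define z0 where "z0 = (\<lambda>i. if i \<in> A then y i else y' i)"
    have z0: "z0 \<in> W'" unfolding z0_def using y(1) y'(1) by (rule mix)
    \<comment> \<open>The first move preserves the coordinates in \<open>B\<close>, so that the
      second one can still aim at \<open>y'\<close>.\<close>
    obtain h z1 where h: "h \<in> stab A" and z1: "z1 \<in> W'" "\<And>a. a \<in> B \<Longrightarrow> z1 a = z0 a" "z1 \<circ> h \<in> N \<inter> W'"
      using stab_moves_into_open[OF A U W'(1) z0 _ B(1)] by (auto simp: z0_def)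
    define O1 where "O1 = W' \<inter> {x. x \<circ> h \<in> N \<inter> W'}"
    have "open O1" unfolding O1_def by (intro open_Int W'(1) open_comp_right[OF U(1)])
    moreover have "z1 \<in> O1" unfolding O1_def using z1 by blast
    ultimately have O1: "open O1" "z1 \<in> O1" .
    have "z1 b = y' b" if "b \<in> B" for b using z1(2)[OF that] that AB by (auto simp: z0_def)
    then obtain h' z2 where h': "h' \<in> stab B" and z2: "z2 \<in> O1" "z2 \<circ> h' \<in> N' \<inter> W'"
      using stab_moves_into_open[OF B U' O1, of "{}"] by auto
    have "open (O1 \<inter> {x. x \<circ> h' \<in> N' \<inter> W'})" by (intro open_Int O1(1) open_comp_right U'(1))
    then obtain z where z: "z \<in> W'" "z \<circ> h \<in> N \<inter> W'" "z \<circ> h' \<in> N' \<inter> W'" "z \<in> C"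
      using open_meets_C[of "O1 \<inter> {x. x \<circ> h' \<in> N' \<inter> W'}"] z2 unfolding O1_def by blast
    have zC: "z \<circ> h \<in> C" "z \<circ> h' \<in> C" using z(4) stab_Q h h' by (auto intro: C_inv)
    \<comment> \<open>Invariance under \<open>stab A\<close> puts \<open>\<alpha> z\<close> in
      \<open>M\<close>. Passing to \<open>\<beta>\<close>, moving by an element of
      \<open>stab B\<close> and passing back puts the same number in \<open>M'\<close>.\<close>
    have "\<alpha> z = \<alpha> (z \<circ> h)" using invA[of z h] z h W'(3) by auto
    then have 1: "\<alpha> z \<in> M" using N(2) z(2) zC(1) by auto
    have "\<beta> z = \<beta> (z \<circ> h')" using invB[of z h'] z h' W'(3) by auto
    also have "\<dots> = \<alpha> (z \<circ> h')" using eq[of "z \<circ> h'"] z(3) zC(2) W'(3) by auto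
    finally have "\<alpha> z = \<alpha> (z \<circ> h')" using eq[of z] z W'(3) by auto
    then have "\<alpha> z \<in> M'" using N'(2) z(3) zC(2) by auto
    with 1 M(5) show False by blast
  qed
  moreover obtain v where "v \<in> W'" "v \<in> C" using open_meets_C[OF W'(1)] W'(2) by blast
  ultimately show ?thesis using that[OF W'(1) _ W'(3), of "\<alpha> v"] by blast
qed

text \<open>Since \<open>p\<close> preserves the range, \<open>f y k\<close> and
  \<open>f (y \<circ> p) k\<close> belong to one clique, while they are governed by disjoint sets of
  coordinates. The conclusion speaks of \<open>saturation A U\<close> because \<open>y\<close> and
  \<open>y \<circ> p\<close> must meet the local condition together: \<open>U\<close> may restrict
  coordinates outside \<open>A\<close> and prevent this, whereas the saturation restricts only those
  in \<open>A\<close>.\<close>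

lemma invariant_coordinate_constant:
  assumes A: "finite A" "closed_under F A" and U: "open U" "U \<noteq> {}"
    and inv: "\<And>y h. y \<in> U \<Longrightarrow> y \<in> C \<Longrightarrow> h \<in> stab A \<Longrightarrow> f (y \<circ> h) k = f y k"
  obtains W c where "open W" "W \<noteq> {}" "W \<subseteq> saturation A U" "\<And>y. y \<in> W \<Longrightarrow> y \<in> C \<Longrightarrow> f y k = c"
proof -
  define S where "S = saturation A U"
  define \<phi> where "\<phi> y = f y k" for y
  have \<phi>: "continuous_on C \<phi>" unfolding \<phi>_def by (rule f_cont)
  have S: "open S" "S \<noteq> {}" unfolding S_def
    using open_saturation[OF U(1)] saturation_superset[of U A] U(2) by auto
  have Sinv: "\<phi> (y \<circ> h) = \<phi> y" if "y \<in> S" "y \<in> C" "h \<in> stab A" for y h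
    using stab_invariance_saturation[OF A U(1) \<phi> _ _ that(2,3)] inv that(1) unfolding \<phi>_def S_def by blast
  obtain g where g: "g \<in> Aut R F" "g ` A \<inter> A = {}"
    using amalgamation[OF A, of "{}"] by (auto simp: closed_under_def)
  obtain p where p: "p \<in> Q" "\<forall>a\<in>A. p a = g a" using Q_dense[OF g(1) A(1)] by blast
  have pA: "A \<inter> p ` A = {}" using g(2) p(2) by auto
  have pAut: "p \<in> Aut R F" using p(1) Q_Aut by blast
  define B where "B = p ` A"
  have pF: "p (F i a b) = F i (p a) (p b)" for i a b using pAut by (simp add: Aut_def)
  have "F i (p a) (p b) \<in> B" if "a \<in> A" "b \<in> A" for i a b
    unfolding B_def pF[symmetric] using closed_underD[OF A(2) that] by (rule imageI)
  then have "closed_under F B" unfolding closed_under_def B_def by blast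
  then have B: "finite B" "closed_under F B" using A(1) by (simp_all add: B_def)
  \<comment> \<open>Conjugation by \<open>p\<close> carries \<open>stab B\<close> into
    \<open>stab A\<close>, so invariance of the entry at \<open>y \<circ> p\<close> becomes
    invariance in \<open>y\<close> under \<open>stab B\<close>.\<close>
  have conj_stab: "inv p \<circ> h \<circ> p \<in> stab A" if "h \<in> stab B" for h
    using that p(1) Q_comp Q_inv Q_bij[OF p(1)] by (auto simp: stab_def B_def bij_is_inj)
  have conj_eq: "y \<circ> h \<circ> p = y \<circ> p \<circ> (inv p \<circ> h \<circ> p)" for y :: "nat \<Rightarrow> real" and h
  proof -
    have "p \<circ> (inv p \<circ> h \<circ> p) = h \<circ> p"
      using Q_bij[OF p(1)] by (auto simp: fun_eq_iff bij_is_surj surj_f_inv_f)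
    then show ?thesis by (simp only: comp_assoc)
  qed
  define S2 where "S2 = S \<inter> {y. y \<circ> p \<in> S}"
  have S2: "open S2" unfolding S2_def by (intro open_Int S(1) open_comp_right)
  obtain w where w: "w \<in> S" using S(2) by blast
  \<comment> \<open>Disjointness of \<open>A\<close> and its image allows \<open>w\<close> to be
    written on \<open>A\<close> and once more, transported by \<open>p\<close>, on the
    image.\<close>
  define y0 where "y0 d = (if d \<in> A then w d else w (inv p d))" for d
  have "y0 \<in> S" using w unfolding S_def by (rule saturation_cong) (simp add: y0_def)
  moreover have "y0 \<circ> p \<in> S" using w unfolding S_def
    by (rule saturation_cong) (use pA Q_bij[OF p(1)] in \<open>auto simp: y0_def bij_is_inj\<close>)
  ultimately have S2_ne: "S2 \<noteq> {}" unfolding S2_def by blast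
  \<comment> \<open>Index \<open>0\<close> stands for the entry itself and \<open>Suc m\<close> for
    its image under \<open>t m\<close>. Equality and adjacency in either direction then share the
    form \<open>\<psi> i y = \<psi> j (y \<circ> p)\<close> with \<open>i = 0\<close> or
    \<open>j = 0\<close>.\<close>
  define \<psi> where "\<psi> i y = (if i = 0 then \<phi> y else t (i - 1) (\<phi> y))" for i :: nat and y
  have \<psi>: "continuous_on C (\<psi> i)" for i
    unfolding \<psi>_def \<phi>_def using f_cont tf_cont by (cases "i = 0") simp_all
  have \<psi>_inv: "\<psi> i (y \<circ> h) = \<psi> i y" if "y \<in> S" "y \<in> C" "h \<in> stab A" for i y h
    using Sinv[OF that] by (simp add: \<psi>_def)
  have pC: "(\<lambda>x. x \<circ> p) ` C \<subseteq> C" using C_inv p(1) by blast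
  have \<psi>p: "continuous_on C (\<lambda>y. \<psi> i (y \<circ> p))" for i
    by (rule continuous_on_compose2[OF \<psi> continuous_on_comp_right pC])
  have \<psi>p_inv: "\<psi> i (y \<circ> h \<circ> p) = \<psi> i (y \<circ> p)" if "y \<in> S2" "y \<in> C" "h \<in> stab B" for i y h
    unfolding conj_eq using that p(1) by (intro \<psi>_inv conj_stab) (auto simp: S2_def intro: C_inv)
  define T where "T e = (case e of (i, j) \<Rightarrow> {y \<in> C. \<psi> i y = \<psi> j (y \<circ> p)})" for e
  define I where "I = {e :: nat \<times> nat. fst e = 0 \<or> snd e = 0}"
  have cover: "S2 \<inter> C \<subseteq> (\<Union>e\<in>I. T e)"
  proof
    fix y assume y: "y \<in> S2 \<inter> C"
    have "\<phi> y \<in> range (f y)" "\<phi> (y \<circ> p) \<in> range (f y)"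
      using f_inv[OF pAut, of y] unfolding \<phi>_def by blast+
    then have "\<phi> y = \<phi> (y \<circ> p) \<or> fgraph t (\<phi> y) (\<phi> (y \<circ> p))"
      using f_clique[of y] unfolding is_clique_def by blast
    then have "\<exists>i j. (i = 0 \<or> j = 0) \<and> \<psi> i y = \<psi> j (y \<circ> p)"
    proof
      assume "\<phi> y = \<phi> (y \<circ> p)"
      then show ?thesis by (intro exI[of _ 0]) (simp add: \<psi>_def)
    next
      assume "fgraph t (\<phi> y) (\<phi> (y \<circ> p))"
      then obtain n where "t n (\<phi> y) = \<phi> (y \<circ> p) \<or> t n (\<phi> (y \<circ> p)) = \<phi> y"
        unfolding fgraph_def by blast
      then have "\<psi> (Suc n) y = \<psi> 0 (y \<circ> p) \<or> \<psi> 0 y = \<psi> (Suc n) (y \<circ> p)" by (auto simp: \<psi>_def)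
      then show ?thesis by blast
    qed
    then obtain i j where "i = 0 \<or> j = 0" "\<psi> i y = \<psi> j (y \<circ> p)" by blast
    then show "y \<in> (\<Union>e\<in>I. T e)" using y by (intro UN_I[of "(i, j)"]) (simp_all add: T_def I_def)
  qed
  have closed_T: "closedin (top_of_set C) (T e)" for e
    unfolding T_def by (cases e) (simp add: closedin_equalizer[OF \<psi> \<psi>p])
  obtain e S3 where e: "e \<in> I" and S3: "open S3" "S3 \<noteq> {}" "S3 \<subseteq> S2" "S3 \<inter> C \<subseteq> T e"
    using comeager_closed_cover[OF C_comeager S2 S2_ne _ closed_T cover] by auto
  obtain i j where ij: "e = (i, j)" by (cases e)
  have eq: "\<psi> i y = \<psi> j (y \<circ> p)" if "y \<in> S3" "y \<in> C" for y
    using S3(4) that unfolding T_def ij by auto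
  have "S3 \<subseteq> S" using S3(3) unfolding S2_def by blast
  obtain W c where W: "open W" "W \<noteq> {}" "W \<subseteq> S3" and c: "\<And>y. y \<in> W \<Longrightarrow> y \<in> C \<Longrightarrow> \<psi> i y = c"
  proof (rule independent_equal_imp_constant[OF A B pA[folded B_def] S3(1,2) \<psi>[of i] \<psi>p[of j] eq])
    show "\<psi> i (y \<circ> h) = \<psi> i y" if "y \<in> S3" "y \<in> C" "h \<in> stab A" for y h
      using \<psi>_inv that \<open>S3 \<subseteq> S\<close> by blast
    show "\<psi> j (y \<circ> h \<circ> p) = \<psi> j (y \<circ> p)" if "y \<in> S3" "y \<in> C" "h \<in> stab B" for y h
      using \<psi>p_inv that S3(3) by blast
  qed blast+
  have WS: "W \<subseteq> S" using W(3) \<open>S3 \<subseteq> S\<close> by blast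
  show ?thesis
  \<comment> \<open>The constant found is that of \<open>\<psi> i\<close>, which is the entry at
    \<open>y\<close> only for \<open>i = 0\<close>. Otherwise \<open>j = 0\<close> and the entry at
    \<open>y \<circ> p\<close> is constant, so the open set is translated by
    \<open>p\<close>.\<close>
  proof (cases "i = 0")
    case True
    then have "f y k = c" if "y \<in> W" "y \<in> C" for y using c[OF that] by (simp add: \<psi>_def \<phi>_def)
    then show ?thesis using that W(1,2) WS unfolding S_def by blast
  next
    case False
    then have j: "j = 0" using e ij by (simp add: I_def)
    show ?thesis
    proof (rule that)
      show "open {x. x \<circ> inv p \<in> W}" by (rule open_comp_right[OF W(1)])
      obtain v where "v \<in> W" using W(2) by blast
      then have "v \<circ> p \<in> {x. x \<circ> inv p \<in> W}" unfolding mem_Collect_eq comp_inv_right[OF p(1)] .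
      then show "{x. x \<circ> inv p \<in> W} \<noteq> {}" by blast
      show "{x. x \<circ> inv p \<in> W} \<subseteq> saturation A U"
      proof
        fix x assume "x \<in> {x. x \<circ> inv p \<in> W}"
        then have "x \<circ> inv p \<circ> p \<in> S" using W(3) S3(3) unfolding S2_def by blast
        then show "x \<in> saturation A U" unfolding comp_inv_left[OF p(1)] S_def .
      qed
      show "f x k = c" if x: "x \<in> {x. x \<circ> inv p \<in> W}" "x \<in> C" for x
      proof -
        have xW: "x \<circ> inv p \<in> W" "x \<circ> inv p \<in> C" using x Q_inv[OF p(1)] C_inv by blast+
        then have "c = \<psi> j (x \<circ> inv p \<circ> p)" using c eq W(3) by auto
        then show ?thesis unfolding comp_inv_left[OF p(1)] j by (simp add: \<psi>_def \<phi>_def)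
      qed
    qed
  qed
qed

text \<open>Locally \<open>f x n\<close> is the entry \<open>k\<close> of a translate of
  \<open>x\<close>, and that entry is invariant under \<open>stab A\<close>. Its constancy is known
  only on an open part of the saturation of \<open>U\<close>, so a further element of
  \<open>stab A\<close> is used to bring points of \<open>U\<close> there.\<close>

lemma locally_constant:
  assumes W: "open W" "W \<noteq> {}"
  obtains W' c where "open W'" "W' \<noteq> {}" "W' \<subseteq> W" "\<And>x. x \<in> W' \<Longrightarrow> x \<in> C \<Longrightarrow> f x n = c"
proof -
  obtain W1 h0 A k where W1: "open W1" "W1 \<noteq> {}" "W1 \<subseteq> W" and h0: "h0 \<in> Q"
    and A: "finite A" "closed_under F A"
    and supp: "\<And>x h. x \<in> W1 \<Longrightarrow> x \<in> C \<Longrightarrow> h \<in> stab A \<Longrightarrow> f (x \<circ> h0 \<circ> h) k = f x n"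
    using locally_uniform_support[OF W, of n] by blast
  define U where "U = {y. y \<circ> inv h0 \<in> W1}"
  have U: "open U" unfolding U_def by (rule open_comp_right[OF W1(1)])
  obtain w where "w \<in> W1" using W1(2) by blast
  then have "w \<circ> h0 \<in> U" unfolding U_def mem_Collect_eq comp_inv_right[OF h0] .
  then have U_ne: "U \<noteq> {}" by blast
  have supp': "f (y \<circ> h) k = f (y \<circ> inv h0) n" if "y \<in> U" "y \<in> C" "h \<in> stab A" for y h
    using supp[of "y \<circ> inv h0" h] that C_inv[OF that(2) Q_inv[OF h0]]
    unfolding comp_inv_left[OF h0] U_def by blast
  have invU: "f (y \<circ> h) k = f y k" if "y \<in> U" "y \<in> C" "h \<in> stab A" for y h
    using supp'[OF that] supp'[OF that(1,2) stab_id] unfolding comp_id by simp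
  obtain O1 c where O1: "open O1" "O1 \<noteq> {}" "O1 \<subseteq> saturation A U" "\<And>y. y \<in> O1 \<Longrightarrow> y \<in> C \<Longrightarrow> f y k = c"
    using invariant_coordinate_constant[OF A U U_ne, of k] invU by blast
  obtain u where u: "u \<in> O1" using O1(2) by blast
  then obtain y where y: "y \<in> U" "\<And>a. a \<in> A \<Longrightarrow> y a = u a" using O1(3) unfolding saturation_def by blast
  obtain h z where h: "h \<in> stab A" and z: "z \<in> U" "z \<circ> h \<in> O1"
    using stab_moves_into_open[OF A O1(1) u U y(1), of "{}"] y(2) by auto
  show ?thesis
  proof
    show "open (W1 \<inter> {x. x \<circ> (h0 \<circ> h) \<in> O1})" by (intro open_Int W1(1) open_comp_right O1(1))
    have "z \<circ> inv h0 \<in> W1" using z(1) unfolding U_def by blast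
    moreover have "z \<circ> inv h0 \<circ> (h0 \<circ> h) = z \<circ> h"
      unfolding comp_assoc[symmetric] comp_inv_left[OF h0] ..
    ultimately have "z \<circ> inv h0 \<in> W1 \<inter> {x. x \<circ> (h0 \<circ> h) \<in> O1}" using z(2) by simp
    then show "W1 \<inter> {x. x \<circ> (h0 \<circ> h) \<in> O1} \<noteq> {}" by blast
    show "W1 \<inter> {x. x \<circ> (h0 \<circ> h) \<in> O1} \<subseteq> W" using W1(3) by blast
    show "f x n = c" if x: "x \<in> W1 \<inter> {x. x \<circ> (h0 \<circ> h) \<in> O1}" "x \<in> C" for x
    proof -
      have "x \<in> W1" using x(1) by blast
      then have "f x n = f (x \<circ> h0 \<circ> h) k" by (rule supp[OF _ x(2) h, symmetric])
      also have "\<dots> = c"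
        unfolding comp_assoc
        by (rule O1(4)[OF _ C_inv[OF x(2) Q_comp[OF h0 stab_Q[OF h]]]]) (use x(1) in blast)
      finally show ?thesis .
    qed
  qed
qed

text \<open>Local constancy alone permits different constants on different pieces. Density of
  \<open>Q\<close>-orbits glues them: the orbit of \<open>y\<close> enters the piece around
  \<open>x\<close>, and invariance of the range brings its constant back to
  \<open>f y\<close>.\<close>

theorem constant_range:
  obtains D where "comeager D" "\<And>x y. x \<in> D \<Longrightarrow> y \<in> D \<Longrightarrow> range (f x) = range (f y)"
proof -
  obtain \<B> :: "(nat \<Rightarrow> real) set set" where \<B>: "countable \<B>" "topological_basis \<B>"
    using ex_countable_basis by auto
  define L where "L n = \<Union>{W. open W \<and> (\<exists>c. \<forall>x\<in>W. x \<in> C \<longrightarrow> f x n = c)}" for n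
  define M where "M U = (\<Union>h\<in>Q. {x. x \<circ> h \<in> U})" for U :: "(nat \<Rightarrow> real) set"
  define D where "D = C \<inter> (\<Inter>n\<in>UNIV. L n) \<inter> (\<Inter>U\<in>\<B> - {{}}. M U)"
  have "comeager (L n)" for n
  proof (rule comeager_openI)
    show "open (L n)" unfolding L_def by (rule open_Union) blast
    show "W \<inter> L n \<noteq> {}" if W: "open W" "W \<noteq> {}" for W
    proof -
      obtain W' c where W': "open W'" "W' \<noteq> {}" "W' \<subseteq> W" "\<And>x. x \<in> W' \<Longrightarrow> x \<in> C \<Longrightarrow> f x n = c"
        using locally_constant[OF W, of n] by blast
      have "\<exists>c. \<forall>x\<in>W'. x \<in> C \<longrightarrow> f x n = c" using W'(4) by (intro exI[of _ c]) simp
      then have "W' \<subseteq> L n" unfolding L_def using W'(1) by (intro Union_upper CollectI conjI)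
      then show ?thesis using W'(2,3) by blast
    qed
  qed
  moreover have "comeager (M U)" if U: "U \<in> \<B> - {{}}" for U
  proof (rule comeager_openI)
    have oU: "open U" using U topological_basis_open[OF \<B>(2)] by blast
    show "open (M U)" unfolding M_def by (intro open_UN ballI open_comp_right[OF oU])
    show "W \<inter> M U \<noteq> {}" if W: "open W" "W \<noteq> {}" for W
    proof -
      obtain u w where "u \<in> U" "w \<in> W" using U W(2) by blast
      then obtain h z where "h \<in> stab {}" "z \<in> W" "z \<circ> h \<in> U"
        using stab_moves_into_open[of "{}" U u W w "{}"] oU W(1) by (auto simp: closed_under_def)
      then show ?thesis unfolding M_def using stab_Q by blast
    qed
  qed
  ultimately have "comeager D"
    unfolding D_def using \<B>(1) by (intro comeager_Int C_comeager comeager_INT) auto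
  moreover have sub: "range (f x) \<subseteq> range (f y)" if x: "x \<in> D" and y: "y \<in> D" for x y
  proof
    fix b assume "b \<in> range (f x)"
    then obtain n where b: "b = f x n" by blast
    have xC: "x \<in> C" and yC: "y \<in> C" using x y by (simp_all add: D_def)
    have "x \<in> L n" using x by (simp add: D_def)
    then obtain W c where W: "open W" "x \<in> W" "\<And>v. v \<in> W \<Longrightarrow> v \<in> C \<Longrightarrow> f v n = c"
      unfolding L_def by blast
    obtain U where U: "U \<in> \<B>" "x \<in> U" "U \<subseteq> W"
      using topological_basisE[OF \<B>(2) W(1,2)] by blast
    then have "y \<in> M U" using y unfolding D_def by blast
    then obtain h where h: "h \<in> Q" "y \<circ> h \<in> U" unfolding M_def by blast
    have "f (y \<circ> h) n = c" using W(3) h U(3) C_inv[OF yC h(1)] by blast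
    moreover have "f x n = c" by (rule W(3)[OF W(2) xC])
    ultimately have "b \<in> range (f (y \<circ> h))" using b by (metis rangeI)
    then show "b \<in> range (f y)" using f_inv[of h y] h(1) Q_Aut by blast
  qed
  ultimately show ?thesis using that[of D] sub by blast
qed

end

section \<open>From Baire measurable maps to the generic setting\<close>

context BKL_structure
begin

lemma invariant_clique_map_constant_range:
  fixes t :: "nat \<Rightarrow> real \<Rightarrow> real" and f :: "(nat \<Rightarrow> real) \<Rightarrow> nat \<Rightarrow> real"
  assumes t: "\<And>m. t m \<in> borel_measurable borel" and f: "baire_measurable f"
    and inv: "\<And>g x. g \<in> Aut R F \<Longrightarrow> range (f (x \<circ> g)) = range (f x)"
    and clique: "\<And>x. is_clique (fgraph t) (range (f x))"
  obtains D where "comeager D" "\<And>x y. x \<in> D \<Longrightarrow> y \<in> D \<Longrightarrow> range (f x) = range (f y)"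
proof -
  obtain Q where Q: "countable Q" "Q \<subseteq> Aut R F" "id \<in> Q"
    "\<forall>g\<in>Q. \<forall>h\<in>Q. g \<circ> h \<in> Q" "\<forall>g\<in>Q. inv g \<in> Q"
    "\<forall>g\<in>Aut R F. \<forall>E. finite E \<longrightarrow> (\<exists>h\<in>Q. \<forall>a\<in>E. h a = g a)"
    using countable_dense_subgroup[of R F] by (elim exE conjE)
  have coord: "baire_measurable (\<lambda>x. f x n)" for n
  proof (rule baire_measurable_borel_comp[OF f])
    show "(\<lambda>y :: nat \<Rightarrow> real. y n) \<in> borel_measurable borel"
      by (intro borel_measurable_continuous_onI continuous_on_product_coordinates)
  qed
  have tcoord: "baire_measurable (\<lambda>x. t m (f x n))" for m n
    by (rule baire_measurable_borel_comp[OF coord t])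
  obtain C1 where C1: "comeager C1" "\<And>n. continuous_on C1 (\<lambda>x. f x n)"
    using baire_measurable_continuous_comeager[of UNIV "\<lambda>n x. f x n"] coord by auto
  obtain C2 where C2: "comeager C2" "\<And>m n. continuous_on C2 (\<lambda>x. t m (f x n))"
    using baire_measurable_continuous_comeager[of UNIV "\<lambda>(m, n) x. t m (f x n)"] tcoord by auto
  obtain V0 :: "nat \<Rightarrow> (nat \<Rightarrow> real) set" where V0: "\<And>n. open (V0 n)" "\<And>n. closure (V0 n) = UNIV"
    "(\<Inter>n. V0 n) \<subseteq> C1 \<inter> C2"
    using comeagerE[OF comeager_Int[OF C1(1) C2(1)]] by blast
  define q where "q = from_nat_into Q"
  have q: "range q = Q" unfolding q_def using Q(1,3) by (intro range_from_nat_into) auto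
  \<comment> \<open>The index codes an element of \<open>Q\<close> and a number, so the intersection
    consists of the points whose \<open>Q\<close>-translates all lie in every \<open>V0 n\<close>.
    Countability of \<open>Q\<close> keeps it comeager, and closure of \<open>Q\<close> under
    composition makes it invariant.\<close>
  define V where "V k = {x. x \<circ> q (fst (prod_decode k)) \<in> V0 (snd (prod_decode k))}" for k
  define C where "C = (\<Inter>k. V k)"
  have C: "x \<in> C \<longleftrightarrow> (\<forall>h\<in>Q. \<forall>n. x \<circ> h \<in> V0 n)" for x
  proof
    assume x: "x \<in> C"
    show "\<forall>h\<in>Q. \<forall>n. x \<circ> h \<in> V0 n"
    proof (intro ballI allI)
      fix h n assume "h \<in> Q"
      then obtain i where i: "h = q i" using q by blast
      have "x \<in> V (prod_encode (i, n))" using x unfolding C_def by blast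
      then show "x \<circ> h \<in> V0 n" by (simp add: V_def i)
    qed
  next
    assume "\<forall>h\<in>Q. \<forall>n. x \<circ> h \<in> V0 n"
    then show "x \<in> C" unfolding C_def V_def using q by blast
  qed
  have V_open: "open (V k)" for k unfolding V_def by (rule open_comp_right[OF V0(1)])
  have "comeager (V k)" for k
  proof (rule comeager_openI[OF V_open])
    fix W :: "(nat \<Rightarrow> real) set" assume W: "open W" "W \<noteq> {}"
    define h where "h = q (fst (prod_decode k))"
    have "bij h" using q Q(2) Aut_bij unfolding h_def by blast
    then have hi: "x \<circ> inv h \<circ> h = x" "x \<circ> h \<circ> inv h = x" for x :: "nat \<Rightarrow> real"
      by (auto simp: fun_eq_iff bij_is_inj bij_is_surj surj_f_inv_f)
    obtain w where "w \<in> W" using W(2) by blast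
    then have "w \<circ> h \<in> {x. x \<circ> inv h \<in> W}" by (simp only: mem_Collect_eq hi)
    moreover have "open {x. x \<circ> inv h \<in> W}" by (rule open_comp_right[OF W(1)])
    ultimately obtain y where y: "y \<circ> inv h \<in> W" "y \<in> V0 (snd (prod_decode k))"
      using V0(2)[of "snd (prod_decode k)"] open_Int_closure_eq_empty[of "{x. x \<circ> inv h \<in> W}"] by blast
    then have "y \<circ> inv h \<in> V k" unfolding V_def h_def[symmetric] mem_Collect_eq hi(1) by blast
    then show "W \<inter> V k \<noteq> {}" using y(1) by blast
  qed
  then have C_comeager: "comeager C" unfolding C_def by (intro comeager_INT) auto
  have C_sub: "C \<subseteq> C1" "C \<subseteq> C2"
    using V0(3) C Q(3) comp_id by (fastforce, fastforce)
  interpret generic_clique_map R F t f Q V C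
  proof
    show "\<And>x h. x \<in> C \<Longrightarrow> h \<in> Q \<Longrightarrow> x \<circ> h \<in> C" using Q(4) unfolding C by (simp only: comp_assoc) blast
    show "\<And>n. continuous_on C (\<lambda>x. f x n)" by (rule continuous_on_subset[OF C1(2) C_sub(1)])
    show "\<And>m n. continuous_on C (\<lambda>x. t m (f x n))" by (rule continuous_on_subset[OF C2(2) C_sub(2)])
  qed (use Q V_open C_comeager inv clique in \<open>simp_all add: C_def\<close>)
  show ?thesis by (rule constant_range) (rule that)
qed

text \<open>The action composes with the inverse, so \<open>x \<circ> g\<close> is the translate of
  \<open>x\<close> by \<open>inv g\<close>.\<close>

lemma orbit_eq_comp:
  assumes "g \<in> Aut R F"
  shows "orbit_eq (Aut R F) x (x \<circ> g)"
  unfolding orbit_eq_def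
  by (rule bexI[OF _ Aut_inv[OF assms]]) (simp add: inv_inv_eq[OF Aut_bij[OF assms]] comp_def)

end

lemma comeager_avoid_coordinate: "comeager {y :: nat \<Rightarrow> real. y i \<noteq> c}"
proof (rule comeager_openI)
  have "open ((\<lambda>y :: nat \<Rightarrow> real. y i) -` (- {c}))"
    by (intro open_vimage continuous_on_product_coordinates) auto
  then show "open {y :: nat \<Rightarrow> real. y i \<noteq> c}" by (simp add: vimage_def)
  fix W :: "(nat \<Rightarrow> real) set" assume W: "open W" "W \<noteq> {}"
  then obtain w where "w \<in> W" by blast
  then obtain X where X: "\<And>j. open (X j)" "\<And>j. w j \<in> X j" "\<And>y. (\<And>j. y j \<in> X j) \<Longrightarrow> y \<in> W"
    using open_fun_contains_box[OF W(1)] by metis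
  have "X i \<noteq> {c}" using X(1)[of i] not_open_singleton by metis
  then obtain r where r: "r \<in> X i" "r \<noteq> c" using X(2)[of i] by blast
  have "w(i := r) \<in> W" by (rule X(3)) (simp add: X(2) r(1))
  then show "W \<inter> {y. y i \<noteq> c} \<noteq> {}" using r(2) by force
qed

text \<open>At coordinate \<open>0\<close>, every point of the orbit of \<open>x\<close> takes one
  of the countably many values of \<open>x\<close>, and a generic point avoids all of them.\<close>

lemma no_comeager_orbit:
  assumes "comeager C"
  shows "\<exists>x\<in>C. \<exists>y\<in>C. \<not> orbit_eq P x y"
proof -
  obtain x where x: "x \<in> C" using comeager_meets_open[OF assms open_UNIV] by blast
  have "comeager (C \<inter> (\<Inter>n\<in>UNIV. {y. y 0 \<noteq> x n}))"
    by (intro comeager_Int assms comeager_INT comeager_avoid_coordinate) auto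
  from comeager_meets_open[OF this open_UNIV]
  obtain y where "y \<in> C" "\<And>n. y 0 \<noteq> x n" by auto
  then show ?thesis using x unfolding orbit_eq_def by metis
qed

theorem theorem1p4:
  fixes f :: "nat \<Rightarrow> real \<Rightarrow> real"
    and R :: "nat \<Rightarrow> nat \<Rightarrow> nat \<Rightarrow> bool"
    and F :: "nat \<Rightarrow> nat \<Rightarrow> nat \<Rightarrow> nat"
  assumes borel_f: "\<And>n. f n \<in> borel_measurable borel"
    and aleph1_clique: "\<exists>C. is_clique (fgraph f) C \<and> (card_of C, cardSuc natLeq) \<in> ordIso"
    and no_bigger_clique: "\<And>C. is_clique (fgraph f) C \<Longrightarrow> (card_of C, cardSuc natLeq) \<in> ordLeq"
    and BKL: "is_BKL2 R F"
  shows "generically_ergodic (orbit_eq (Aut R F)) (clique_seqs (fgraph f))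
            (eq_plus_on (clique_seqs (fgraph f)))
       \<and> \<not> borel_reducible (orbit_eq (Aut R F)) (clique_seqs (fgraph f))
            (eq_plus_on (clique_seqs (fgraph f)))"
proof -
  interpret BKL_structure R F by standard (rule BKL)
  let ?Z = "clique_seqs (fgraph f)" and ?E = "orbit_eq (Aut R F)"
  have erg: "generically_ergodic ?E ?Z (eq_plus_on ?Z)"
    unfolding generically_ergodic_def
  proof (intro allI impI, elim conjE)
    fix e assume e: "\<forall>x. e x \<in> ?Z" "baire_measurable e" "\<forall>x x'. ?E x x' \<longrightarrow> eq_plus_on ?Z (e x) (e x')"
    have inv: "range (e (x \<circ> g)) = range (e x)" if "g \<in> Aut R F" for g x
      using e(3) orbit_eq_comp[OF that, of x] unfolding eq_plus_on_def by metis
    have clique: "is_clique (fgraph f) (range (e x))" for x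
      using e(1) by (simp add: clique_seqs_def)
    obtain D where "comeager D" "\<And>x y. x \<in> D \<Longrightarrow> y \<in> D \<Longrightarrow> range (e x) = range (e y)"
      using invariant_clique_map_constant_range[OF borel_f e(2) inv clique] by blast
    then show "\<exists>C. comeager C \<and> (\<forall>x\<in>C. \<forall>y\<in>C. eq_plus_on ?Z (e x) (e y))"
      using e(1) unfolding eq_plus_on_def by blast
  qed
  moreover have "\<not> borel_reducible ?E ?Z (eq_plus_on ?Z)"
  proof
    assume "borel_reducible ?E ?Z (eq_plus_on ?Z)"
    then obtain e where e: "e \<in> borel_measurable borel" "\<forall>x. e x \<in> ?Z"
      "\<forall>x y. ?E x y \<longleftrightarrow> eq_plus_on ?Z (e x) (e y)"
      unfolding borel_reducible_def by blast
    \<comment> \<open>Ergodicity applies to \<open>e\<close>; as \<open>e\<close> also reflects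
      equivalence, a comeager set would lie in a single orbit.\<close>
    have "baire_measurable e" by (rule baire_measurable_borel_comp[OF baire_measurable_id e(1)])
    then obtain C where "comeager C" "\<forall>x\<in>C. \<forall>y\<in>C. eq_plus_on ?Z (e x) (e y)"
      using erg e(2,3) unfolding generically_ergodic_def by blast
    then show False using no_comeager_orbit[of C "Aut R F"] e(3) by blast
  qed
  ultimately show ?thesis ..
qed

end
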